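(* If the number of time steps $T$ is fixed, then for every $\epsilon>0$ and for any sequence $\{r_n\}_{n\ge1}$ increasing to infinity such that $r_n=o(n^{1/4})$, the variational estimator $\tilde\pi^{1:T}$ satisfies $$\frac12\,\mathbb{P}_{\theta^*}\left(\min_{\sigma\in\mathfrak{S}_Q}\|\tilde\pi^{1:T}_\sigma-\pi^{*1:T}\|_\infty>\frac{\epsilon\, r_n}{n^{1/4}}\right)\xrightarrow[n\to\infty]{}0 .$$
   Context: Notation: $[M]=\{1,\dots,M\}$. Fix $T\ge1$, the number of classes $Q\ge 2$ and constants $0<\delta<1/Q$, $0<\zeta<1/2$. Model (fixed $T$, time-varying connectivity). There are $n$ nodes observed at times $t=1,\dots,T$. The latent labels $Z_i=(Z_i^1,\dots,Z_i^T)$, $i\in[n]$, are i.i.d. homogeneous stationary Markov chains on $[Q]$ with transition matrix $\Gamma=(\gamma_{ql})_{q,l\in[Q]}$, started from its stationary distribution $\alpha$. Write $Z^t=(Z_1^t,\dots,Z_n^t)$, $Z^{1:T}=(Z^1,\dots,Z^T)$. The observations $X^{1:T}=(X^1,\dots,X^T)$ are symmetric binary adjacency matrices $X^t=(X^t_{ij})_{i,j\in[n]}$ with $X^t_{ii}=0$; conditionally on $Z^{1:T}$, the $X^t_{ij}$ ($i<j$, $t\in[T]$) are independent and $X^t_{ij}$ is Bernoulli with parameter $\pi^t_{Z^t_iZ^t_j}$, where $\pi^{1:T}=(\pi^1,\dots,\pi^T)$ and each $\pi^t=(\pi^t_{ql})$ is a symmetric $Q\times Q$ matrix. The parameter is $\theta=(\Gamma,\pi^{1:T})$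 and $\mathbb{P}_\theta$ is the law of all variables under $\theta$. $\Theta^T$ is the set of $\theta=(\Gamma,\pi^{1:T})$ (with $\Gamma$ stochastic, $\pi^t$ symmetric) such that: for every $t$ and all $q\ne q'$ there is $l$ with $\pi^t_{ql}\ne\pi^t_{q'l}$; $\gamma_{ql}\in[\delta,1-\delta]$ for all $q,l$; $\pi^t_{ql}\in[\zeta,1-\zeta]$ for all $t,q,l$; and for every $q$ the value $\pi^t_{qq}=:\pi_{qq}$ does not depend on $t$, with $\{\pi_{qq}:q\in[Q]\}$ being $Q$ distinct values. The true parameter is $\theta^*=(\Gamma^*,\pi^{*1:T})\in\Theta^T$. Variational estimator. The variational family consists of the laws $\mathbb{Q}_\chi$ of $Z^{1:T}$, $\chi=(\tau,\eta)=(\{\tau^t_{iq}\},\{\eta^t_{iql}\})$ with entries in $[0,1]$, under which $Z_1,\dots,Z_n$ are independent, each $Z_i$ is a (possibly inhomogeneous) Markov chain on $[Q]$, $\mathbb{Q}_\chi(Z_i^t=q)=\tau^t_{iq}$ and $\mathbb{Q}_\chi(Z_i^t=q,Z_i^{t+1}=l)=\eta^t_{iql}$. With $\ell(\theta)=\log\mathbb{P}_\theta(X^{1:T})$ and $KL$ the Kullback–Leibler divergence, $$\mathcal{J}(\chi,\theta)=\ell(\theta)-KL\left(\mathbb{Q}_\chi,\mathbb{P}_\theta(Z^{1:T}=\cdot\mid X^{1:T})\right),\quad \hat\chi(\theta)=\operatorname{argmax}_\chi\mathcal{J}(\chi,\theta),\quad \tilde\theta=(\tilde\Gamma,\tilde\pi^{1:T})=\operatorname{argmax}_{\theta\in\Theta^T}\mathcal{J}(\hat\chi(\theta),\theta).$$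 $\mathfrak{S}_Q$ is the set of permutations of $[Q]$; $\pi^{1:T}_\sigma=(\pi^t_\sigma)_{t\in[T]}$ with $\pi^t_\sigma=(\pi^t_{\sigma(q)\sigma(l)})_{q,l}$; $\|\pi^{1:T}-\pi'^{1:T}\|_\infty=\max_{q,l,t}|\pi^t_{ql}-\pi'^t_{ql}|$. A sequence increasing to infinity is a positive sequence tending to $+\infty$. *)

theory Defs
  imports "HOL-Probability.Probability"
begin

text \<open>
  The classes are the elements of a finite type \<open>'q\<close>, so \<open>Q = CARD('q)\<close>. Nodes are \<open>1..n\<close>, times
  are \<open>1..T\<close>. A label configuration \<open>z\<close> has \<open>z i t\<close> as the class of node \<open>i\<close> at time \<open>t\<close>
  (\<open>undefined\<close> outside the ranges), and an observation \<open>x\<close> has \<open>x t i j\<close> true iff nodes \<open>i\<close> and \<open>j\<close>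
  are linked at time \<open>t\<close> (\<open>False\<close> outside the ranges).
\<close>

type_synonym 'q labels = "nat \<Rightarrow> nat \<Rightarrow> 'q"
type_synonym graphs = "nat \<Rightarrow> nat \<Rightarrow> nat \<Rightarrow> bool"
type_synonym 'q param = "(real^'q^'q) \<times> (nat \<Rightarrow> real^'q^'q)"
type_synonym 'q vparam = "(nat \<Rightarrow> nat \<Rightarrow> 'q \<Rightarrow> real) \<times> (nat \<Rightarrow> nat \<Rightarrow> 'q \<Rightarrow> 'q \<Rightarrow> real)"

definition param_space :: "nat \<Rightarrow> real \<Rightarrow> real \<Rightarrow> 'q::finite param set" where
  "param_space T \<delta> \<zeta> = {(\<Gamma>, \<pi>).
     (\<forall>q. (\<Sum>l\<in>UNIV. \<Gamma> $ q $ l) = 1) \<and>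
     (\<forall>q l. \<Gamma> $ q $ l \<in> {\<delta>..1 - \<delta>}) \<and>
     (\<forall>t\<in>{1..T}. transpose (\<pi> t) = \<pi> t) \<and>
     (\<forall>t\<in>{1..T}. \<forall>q q'. q \<noteq> q' \<longrightarrow> (\<exists>l. \<pi> t $ q $ l \<noteq> \<pi> t $ q' $ l)) \<and>
     (\<forall>t\<in>{1..T}. \<forall>q l. \<pi> t $ q $ l \<in> {\<zeta>..1 - \<zeta>}) \<and>
     (\<forall>s\<in>{1..T}. \<forall>t\<in>{1..T}. \<forall>q. \<pi> s $ q $ q = \<pi> t $ q $ q) \<and>
     (\<forall>t\<in>{1..T}. inj (\<lambda>q. \<pi> t $ q $ q))}"

text \<open>
  Law of a Markov chain at times \<open>1..T\<close> with initial law \<open>a\<close>, where \<open>K t q\<close> is the law of the state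
  at time \<open>t + 1\<close> given state \<open>q\<close> at time \<open>t\<close>.
\<close>
primrec chain_pmf :: "'q pmf \<Rightarrow> (nat \<Rightarrow> 'q \<Rightarrow> 'q pmf) \<Rightarrow> nat \<Rightarrow> (nat \<Rightarrow> 'q) pmf" where
  "chain_pmf a K 0 = return_pmf (\<lambda>_. undefined)"
| "chain_pmf a K (Suc t) =
     bind_pmf (chain_pmf a K t) (\<lambda>z.
       map_pmf (\<lambda>q. z(Suc t := q)) (if t = 0 then a else K t (z t)))"

definition kernel :: "real^'q^'q \<Rightarrow> 'q::finite \<Rightarrow> 'q pmf" where
  "kernel \<Gamma> q = embed_pmf (\<lambda>l. \<Gamma> $ q $ l)"

definition stationary :: "real^'q^'q \<Rightarrow> 'q::finite pmf" where
  "stationary \<Gamma> = (THE a. bind_pmf a (kernel \<Gamma>) = a)"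

definition latent_law :: "nat \<Rightarrow> nat \<Rightarrow> real^'q^'q \<Rightarrow> 'q::finite labels pmf" where
  "latent_law n T \<Gamma> =
     Pi_pmf {1..n} (\<lambda>_. undefined) (\<lambda>_. chain_pmf (stationary \<Gamma>) (\<lambda>_. kernel \<Gamma>) T)"

text \<open>
  The independent edge indicators are indexed by \<open>(t, i, j)\<close> with \<open>i < j\<close>. They are \<open>False\<close> off this
  index set, so the \<open>min\<close>/\<open>max\<close> symmetrization has an empty diagonal.
\<close>
definition graph_law ::
    "nat \<Rightarrow> nat \<Rightarrow> (nat \<Rightarrow> real^'q^'q) \<Rightarrow> 'q::finite labels \<Rightarrow> graphs pmf" where
  "graph_law n T \<pi> z =
     map_pmf (\<lambda>e t i j. e (t, min i j, max i j))
       (Pi_pmf {(t, i, j). t \<in> {1..T} \<and> 1 \<le> i \<and> i < j \<and> j \<le> n} False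
          (\<lambda>(t, i, j). bernoulli_pmf (\<pi> t $ z i t $ z j t)))"

definition joint_law :: "nat \<Rightarrow> nat \<Rightarrow> 'q::finite param \<Rightarrow> ('q labels \<times> graphs) pmf" where
  "joint_law n T \<theta> =
     bind_pmf (latent_law n T (fst \<theta>)) (\<lambda>z. map_pmf (Pair z) (graph_law n T (snd \<theta>) z))"

definition obs_law :: "nat \<Rightarrow> nat \<Rightarrow> 'q::finite param \<Rightarrow> graphs pmf" where
  "obs_law n T \<theta> = map_pmf snd (joint_law n T \<theta>)"

definition graph_space :: "nat \<Rightarrow> nat \<Rightarrow> graphs set" where
  "graph_space n T = {x. \<forall>t i j. x t i j \<longrightarrow>
     t \<in> {1..T} \<and> i \<in> {1..n} \<and> j \<in> {1..n} \<and> i \<noteq> j \<and> x t j i}"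

definition posterior :: "nat \<Rightarrow> nat \<Rightarrow> 'q::finite param \<Rightarrow> graphs \<Rightarrow> 'q labels pmf" where
  "posterior n T \<theta> x = map_pmf fst (cond_pmf (joint_law n T \<theta>) {zx. snd zx = x})"

definition log_lik :: "nat \<Rightarrow> nat \<Rightarrow> graphs \<Rightarrow> 'q::finite param \<Rightarrow> real" where
  "log_lik n T x \<theta> = ln (pmf (obs_law n T \<theta>) x)"

text \<open>
  The two marginal families determine a Markov law, hence the law \<open>R\<close> below is unique when it exists.
\<close>
definition is_var_law :: "nat \<Rightarrow> nat \<Rightarrow> 'q::finite vparam \<Rightarrow> 'q labels pmf \<Rightarrow> bool" where
  "is_var_law n T = (\<lambda>(\<tau>, \<eta>) R.
     (\<exists>a K. R = Pi_pmf {1..n} (\<lambda>_. undefined) (\<lambda>i. chain_pmf (a i) (K i) T)) \<and>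
     (\<forall>i\<in>{1..n}. \<forall>t\<in>{1..T}. \<forall>q. measure_pmf.prob R {z. z i t = q} = \<tau> t i q) \<and>
     (\<forall>i\<in>{1..n}. \<forall>t\<in>{1..<T}. \<forall>q l.
        measure_pmf.prob R {z. z i t = q \<and> z i (t + 1) = l} = \<eta> t i q l))"

definition var_space :: "nat \<Rightarrow> nat \<Rightarrow> 'q::finite vparam set" where
  "var_space n T = {chi. \<exists>R. is_var_law n T chi R}"

definition var_law :: "nat \<Rightarrow> nat \<Rightarrow> 'q::finite vparam \<Rightarrow> 'q labels pmf" where
  "var_law n T chi = (THE R. is_var_law n T chi R)"

text \<open>
  \<^const>\<open>KL_divergence\<close> takes the reference law first: \<open>KL(N, M)\<close> is \<open>KL_divergence b M N\<close>.
\<close>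
definition elbo :: "nat \<Rightarrow> nat \<Rightarrow> graphs \<Rightarrow> 'q::finite vparam \<Rightarrow> 'q param \<Rightarrow> real" where
  "elbo n T x chi \<theta> = log_lik n T x \<theta> -
     KL_divergence (exp 1) (measure_pmf (posterior n T \<theta> x)) (measure_pmf (var_law n T chi))"

definition is_chi_hat ::
    "nat \<Rightarrow> nat \<Rightarrow> graphs \<Rightarrow> 'q::finite param \<Rightarrow> 'q vparam \<Rightarrow> bool" where
  "is_chi_hat n T x \<theta> chi \<longleftrightarrow>
     is_arg_max (\<lambda>chi'. elbo n T x chi' \<theta>) (\<lambda>chi'. chi' \<in> var_space n T) chi"

text \<open>
  \<^const>\<open>param_space\<close> is not closed, so for some graphs, e.g. the complete graph at all times, no
  maximizer exists.
\<close>
definition is_theta_tilde ::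
    "nat \<Rightarrow> nat \<Rightarrow> real \<Rightarrow> real \<Rightarrow> graphs \<Rightarrow> ('q::finite param \<Rightarrow> 'q vparam) \<Rightarrow> 'q param \<Rightarrow> bool" where
  "is_theta_tilde n T \<delta> \<zeta> x chihat \<theta> \<longleftrightarrow>
     is_arg_max (\<lambda>\<theta>'. elbo n T x (chihat \<theta>') \<theta>') (\<lambda>\<theta>'. \<theta>' \<in> param_space T \<delta> \<zeta>) \<theta>"

definition permute_classes ::
    "('q \<Rightarrow> 'q) \<Rightarrow> (nat \<Rightarrow> real^'q^'q) \<Rightarrow> nat \<Rightarrow> real^'q^('q::finite)" where
  "permute_classes \<sigma> \<pi> t = (\<chi> q l. \<pi> t $ \<sigma> q $ \<sigma> l)"

definition dist_max ::
    "nat \<Rightarrow> (nat \<Rightarrow> real^'q^'q) \<Rightarrow> (nat \<Rightarrow> real^'q^('q::finite)) \<Rightarrow> real" where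
  "dist_max T \<pi> \<pi>' = Max ((\<lambda>(t, q, l). \<bar>\<pi> t $ q $ l - \<pi>' t $ q $ l\<bar>) ` ({1..T} \<times> UNIV \<times> UNIV))"

definition dist_up_to_perm ::
    "nat \<Rightarrow> (nat \<Rightarrow> real^'q^'q) \<Rightarrow> (nat \<Rightarrow> real^'q^('q::finite)) \<Rightarrow> real" where
  "dist_up_to_perm T \<pi> \<pi>' =
     Min ((\<lambda>\<sigma>. dist_max T (permute_classes \<sigma> \<pi>) \<pi>') ` {\<sigma>. \<sigma> permutes UNIV})"

end

theory Submission
  imports Defs
begin

text \<open>
  The variational criterion at \<open>\<theta>\<close> differs from the profile log-likelihood, the maximum over labellings
  \<open>z\<close> of the log-likelihood of the graphs given \<open>z\<close>, by at most a multiple of \<open>n\<close>. For the lower bound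
  one uses point masses as variational laws (\<open>profile_ge\<close>), since every labelling has prior probability at least
  \<open>\<delta> ^ (T * n)\<close>; for the upper bound one uses that divergences are nonnegative (\<open>profile_le\<close>). So
  the variational estimator nearly maximizes the profile log-likelihood, whatever the optimal variational laws are.

  Uniformly over all labellings and all admissible connectivities, the log-likelihood deviates from its conditional
  mean by at most a multiple of \<open>n powr (3/2)\<close>: the noise enters only through its sums over pairs of vertex sets,
  of which there are \<open>4 ^ n\<close>, and Hoeffding's inequality beats this number (\<open>noise_bounded_tail\<close>). The loss in
  conditional mean is a sum of Bernoulli divergences, which dominate squared errors. Hence the estimated and the true
  connection probabilities differ by \<open>O(n powr (3/2))\<close> in total squared error over all pairs of nodes
  (\<open>squared_error_le\<close>). Each true class has at least a fixed fraction of the nodes with high probability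
  (\<open>classes_large_tail\<close>), so by the pigeonhole principle it shares a fixed fraction of them with one estimated class,
  and every entry of \<open>\<pi>\<close> is estimated from a block of order \<open>n\<^sup>2\<close> pairs. This bounds its squared error by
  \<open>O(n powr (- 1/2))\<close> (\<open>block_error_le\<close>) and its error by \<open>O(n powr (- 1/4))\<close>, which is below
  \<open>\<epsilon> * r n / n powr (1/4)\<close> eventually since \<open>r\<close> tends to infinity. The matching of classes found in
  this way is a permutation, the same at all times, because the diagonal values are distinct and do not change with
  time (\<open>align_classes\<close>).

  The parameter space is not closed, so it has to be shown that the estimator exists on the event considered. Every
  competitor of the true parameter is close to it up to a permutation, hence the identifiability conditions hold with a
  margin among competitors, and the continuous criterion attains its maximum (\<open>theta_tilde_exists\<close>). Continuity
  involves the stationary law of the chain, which is Lipschitz in the transition matrix because matrices with entries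
  bounded below contract (\<open>stationary_lipschitz\<close>).
\<close>

section \<open>Finite Markov chains\<close>

text \<open>
  The trajectories on times \<open>1..T\<close>, padded by \<open>undefined\<close> exactly as \<^const>\<open>chain_pmf\<close> pads them, so that every
  chain law lives on this finite set.
\<close>
definition paths :: "nat \<Rightarrow> (nat \<Rightarrow> 'q) set" where
  "paths T = PiE_dflt {1..T} undefined (\<lambda>_. UNIV)"

lemma finite_paths [simp, intro]: "finite (paths T :: (nat \<Rightarrow> 'q::finite) set)"
  unfolding paths_def by (rule finite_PiE_dflt) auto

lemma paths_iff: "w \<in> paths T \<longleftrightarrow> (\<forall>t. t \<notin> {1..T} \<longrightarrow> w t = undefined)"
  by (auto simp: paths_def PiE_dflt_def)

lemma paths_Suc_iff: "w \<in> paths (Suc t) \<longleftrightarrow> w(Suc t := undefined) \<in> paths t"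
  by (auto simp: paths_iff)

lemma set_chain_subset_paths: "set_pmf (chain_pmf a K T) \<subseteq> paths T"
proof (induction T)
  case 0
  then show ?case by (simp add: paths_iff)
next
  case (Suc t)
  show ?case
  proof
    fix w assume "w \<in> set_pmf (chain_pmf a K (Suc t))"
    then obtain z q where z: "z \<in> set_pmf (chain_pmf a K t)" "w = z(Suc t := q)"
      by auto
    with Suc have "z \<in> paths t" by blast
    with z show "w \<in> paths (Suc t)" by (auto simp: paths_iff)
  qed
qed

text \<open>
  The Markov factorization of a trajectory's probability. Erasing the state at time \<open>Suc t\<close> gives the only
  trajectory of length \<open>t\<close> from which \<open>w\<close> can have been extended, so the sum hidden in
  \<^const>\<open>bind_pmf\<close> has a single term. Lower bounds and continuity in the parameter follow from this recursion
  by induction.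
\<close>
lemma pmf_chain_Suc:
  "pmf (chain_pmf a K (Suc t)) w =
     pmf (chain_pmf a K t) (w(Suc t := undefined)) * pmf (if t = 0 then a else K t (w t)) (w (Suc t))"
proof -
  let ?w = "w(Suc t := undefined)"
  let ?p = "\<lambda>z. if t = 0 then a else K t (z t)"
  have *: "pmf (map_pmf (\<lambda>q. z(Suc t := q)) (?p z)) w =
             (if z = ?w then pmf (?p w) (w (Suc t)) else 0)" if "z \<in> set_pmf (chain_pmf a K t)" for z
  proof -
    have z: "z (Suc t) = undefined"
      using that set_chain_subset_paths[of a K t] by (auto simp: paths_iff)
    show ?thesis
    proof (cases "z = ?w")
      case True
      have "inj (\<lambda>q. z(Suc t := q))" by (auto simp: inj_def dest: fun_upd_eqD)
      from pmf_map_inj'[OF this, of "?p z" "w (Suc t)"] True show ?thesis by auto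
    next
      case False
      have "w \<noteq> z(Suc t := q)" for q
        using False z by (metis fun_upd_triv fun_upd_upd)
      then show ?thesis using False by (subst pmf_map_outside) auto
    qed
  qed
  have "pmf (chain_pmf a K (Suc t)) w =
      (\<integral>z. pmf (map_pmf (\<lambda>q. z(Suc t := q)) (?p z)) w \<partial>measure_pmf (chain_pmf a K t))"
    by (simp add: pmf_bind)
  also have "\<dots> = (\<integral>z. (if z = ?w then pmf (?p w) (w (Suc t)) else 0) \<partial>measure_pmf (chain_pmf a K t))"
    using * by (intro integral_cong_AE) (auto simp: AE_measure_pmf_iff)
  also have "\<dots> = (\<Sum>z\<in>{?w}. (if z = ?w then pmf (?p w) (w (Suc t)) else 0) * pmf (chain_pmf a K t) z)"
    by (rule integral_measure_pmf_real) (auto split: if_splits)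
  finally show ?thesis by simp
qed

lemma pmf_chain_ge:
  assumes "0 \<le> c" "\<And>q. c \<le> pmf a q" "\<And>t q l. c \<le> pmf (K t q) l" "w \<in> paths T"
  shows "c ^ T \<le> pmf (chain_pmf a K T) w"
  using assms(4)
proof (induction T arbitrary: w)
  case 0
  then have "w = (\<lambda>_. undefined)" by (auto simp: paths_iff)
  then show ?case by simp
next
  case (Suc t)
  have "c ^ t \<le> pmf (chain_pmf a K t) (w(Suc t := undefined))"
    using Suc by (simp add: paths_Suc_iff)
  moreover have "c \<le> pmf (if t = 0 then a else K t (w t)) (w (Suc t))" using assms by simp
  ultimately have "c ^ t * c \<le> pmf (chain_pmf a K (Suc t)) w"
    unfolding pmf_chain_Suc using assms(1) by (intro mult_mono) auto
  then show ?case by (simp add: mult.commute)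
qed

lemma prob_bind_pmf:
  "measure_pmf.prob (bind_pmf M f) A = (\<integral>z. measure_pmf.prob (f z) A \<partial>measure_pmf M)"
  unfolding measure_pmf_bind
  using measurable_measure_pmf[of f]
  by (intro measure_pmf.measure_bind[where N = "count_space UNIV"]) auto

text \<open>
  Whatever the past is, the last transition reaches \<open>q\<close> with probability at least \<open>c\<close>; later
  transitions do not change the state at time \<open>t\<close>.
\<close>
lemma prob_chain_state_ge:
  assumes "\<And>q. c \<le> pmf a q" "\<And>t q l. c \<le> pmf (K t q) l" "t \<in> {1..T}"
  shows "c \<le> measure_pmf.prob (chain_pmf a K T) {w. w t = q}"
  using assms(3)
proof (induction T)
  case 0
  then show ?case by simp
next
  case (Suc T)
  have bind: "measure_pmf.prob (chain_pmf a K (Suc T)) A =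
      (\<integral>z. measure_pmf.prob (map_pmf (\<lambda>q. z(Suc T := q)) (if T = 0 then a else K T (z T))) A
         \<partial>measure_pmf (chain_pmf a K T))" for A
    unfolding chain_pmf.simps(2) by (rule prob_bind_pmf)
  show ?case
  proof (cases "t = Suc T")
    case True
    have "pmf (if T = 0 then a else K T (z T)) q =
      measure_pmf.prob (map_pmf (\<lambda>q. z(Suc T := q)) (if T = 0 then a else K T (z T))) {w. w t = q}" for z
      using True by (simp add: vimage_def pmf.rep_eq)
    then have "c \<le> measure_pmf.prob (map_pmf (\<lambda>q. z(Suc T := q)) (if T = 0 then a else K T (z T))) {w. w t = q}" for z
      using assms by (metis (full_types))
    then show ?thesis unfolding bind
      by (intro measure_pmf.integral_ge_const) (auto intro!: measure_pmf.integrable_const_bound[where B=1])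
  next
    case False
    then have "t \<in> {1..T}" "t \<noteq> Suc T" using Suc.prems by auto
    have "measure_pmf.prob (map_pmf (\<lambda>q. z(Suc T := q)) (if T = 0 then a else K T (z T))) {w. w t = q}
        = indicator {w. w t = q} z" for z
      using \<open>t \<noteq> Suc T\<close> by (auto simp: vimage_def indicator_def)
    then have "measure_pmf.prob (chain_pmf a K (Suc T)) {w. w t = q} = measure_pmf.prob (chain_pmf a K T) {w. w t = q}"
      unfolding bind by simp
    then show ?thesis using Suc.IH \<open>t \<in> {1..T}\<close> by simp
  qed
qed

section \<open>The stationary law\<close>

text \<open>
  The minorization \<open>c \<le> \<Gamma> $ q $ l\<close> makes \<open>\<Gamma>\<close> a strict contraction on differences of
  probability vectors, with a factor that is uniform over the set.
\<close>
definition pos_stochastic :: "real \<Rightarrow> (real^'q^'q::finite) set" where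
  "pos_stochastic c = {\<Gamma>. (\<forall>q. (\<Sum>l\<in>UNIV. \<Gamma> $ q $ l) = 1) \<and> (\<forall>q l. c \<le> \<Gamma> $ q $ l)}"

lemma pmf_kernel:
  assumes "\<Gamma> \<in> pos_stochastic c" "0 < c"
  shows "pmf (kernel \<Gamma> q) l = \<Gamma> $ q $ l"
  unfolding kernel_def
proof (rule pmf_embed_pmf)
  show nn: "0 \<le> \<Gamma> $ q $ l" for l
    using assms by (auto simp: pos_stochastic_def intro: order_trans[of 0 c])
  show "(\<integral>\<^sup>+ l. ennreal (\<Gamma> $ q $ l) \<partial>count_space UNIV) = 1"
    using assms nn by (auto simp: nn_integral_count_space_finite pos_stochastic_def sum_ennreal)
qed

lemma pmf_bind_kernel:
  assumes "\<Gamma> \<in> pos_stochastic c" "0 < c"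
  shows "pmf (bind_pmf a (kernel \<Gamma>)) l = (\<Sum>q\<in>UNIV. pmf a q * \<Gamma> $ q $ l)"
  by (simp add: pmf_bind integral_measure_pmf[where A = UNIV] pmf_kernel[OF assms])

text \<open>
  Subtracting the constant \<open>c\<close> from all entries does not change the action of \<open>\<Gamma>\<close> on vectors
  of total mass zero, and leaves a nonnegative matrix with row sums \<open>1 - Q c\<close>, where \<open>Q\<close> is the number of
  states.
\<close>
lemma dobrushin_contraction:
  fixes \<Gamma> :: "real^'q^'q::finite" and d :: "'q \<Rightarrow> real"
  assumes \<Gamma>: "\<Gamma> \<in> pos_stochastic c" and d: "(\<Sum>q\<in>UNIV. d q) = 0"
  shows "(\<Sum>l\<in>UNIV. \<bar>\<Sum>q\<in>UNIV. d q * \<Gamma> $ q $ l\<bar>) \<le> (1 - real CARD('q) * c) * (\<Sum>q\<in>UNIV. \<bar>d q\<bar>)"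
proof -
  have "(\<Sum>q\<in>UNIV. d q * \<Gamma> $ q $ l) = (\<Sum>q\<in>UNIV. d q * (\<Gamma> $ q $ l - c))" for l
    using d by (simp add: right_diff_distrib sum_subtractf flip: sum_distrib_right)
  then have "(\<Sum>l\<in>UNIV. \<bar>\<Sum>q\<in>UNIV. d q * \<Gamma> $ q $ l\<bar>) \<le> (\<Sum>l\<in>UNIV. \<Sum>q\<in>UNIV. \<bar>d q\<bar> * (\<Gamma> $ q $ l - c))"
    using \<Gamma> by (auto simp: pos_stochastic_def abs_mult intro!: sum_mono order_trans[OF sum_abs])
  also have "\<dots> = (\<Sum>q\<in>UNIV. \<bar>d q\<bar> * (\<Sum>l\<in>UNIV. \<Gamma> $ q $ l - c))"
    by (subst sum.swap) (simp add: sum_distrib_left)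
  also have "\<dots> = (1 - real CARD('q) * c) * (\<Sum>q\<in>UNIV. \<bar>d q\<bar>)"
    using \<Gamma> by (simp add: pos_stochastic_def sum_subtractf sum_distrib_right mult.commute)
  finally show ?thesis .
qed

lemma invariant_law_unique:
  fixes \<Gamma> :: "real^'q^'q::finite"
  assumes \<Gamma>: "\<Gamma> \<in> pos_stochastic c" "0 < c"
    and a: "bind_pmf a (kernel \<Gamma>) = a" and b: "bind_pmf b (kernel \<Gamma>) = b"
  shows "a = b"
proof -
  let ?d = "\<lambda>q. pmf a q - pmf b q"
  let ?S = "\<Sum>q\<in>UNIV. \<bar>?d q\<bar>"
  have "(\<Sum>q\<in>UNIV. ?d q * \<Gamma> $ q $ l) = ?d l" for l
    using pmf_bind_kernel[OF \<Gamma>, of a l] pmf_bind_kernel[OF \<Gamma>, of b l]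
    by (simp add: a b left_diff_distrib sum_subtractf)
  moreover have "(\<Sum>q\<in>UNIV. ?d q) = 0" by (simp add: sum_subtractf sum_pmf_eq_1)
  ultimately have "?S \<le> (1 - real CARD('q) * c) * ?S"
    using dobrushin_contraction[OF \<Gamma>(1), of ?d] by simp
  then have "real CARD('q) * c * ?S \<le> 0" by (simp add: algebra_simps)
  then have "?S \<le> 0" using \<Gamma>(2) by (simp add: mult_le_0_iff)
  then have "?S = 0" by (intro antisym sum_nonneg) auto
  then have "pmf a q = pmf b q" for q by (simp add: sum_nonneg_eq_0_iff)
  then show ?thesis by (simp add: pmf_eq_iff)
qed

text \<open>
  Brouwer's theorem on the simplex, which \<open>\<Gamma>\<close> maps continuously to itself.
\<close>
lemma invariant_law_exists:
  fixes \<Gamma> :: "real^'q^'q::finite"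
  assumes \<Gamma>: "\<Gamma> \<in> pos_stochastic c" "0 < c"
  shows "\<exists>a. bind_pmf a (kernel \<Gamma>) = a"
proof -
  let ?S = "{v :: real^'q. (\<forall>i. 0 \<le> v $ i) \<and> (\<Sum>i\<in>UNIV. v $ i) = 1}"
  let ?f = "\<lambda>v :: real^'q. (\<chi> l. \<Sum>q\<in>UNIV. v $ q * \<Gamma> $ q $ l) :: real^'q"
  have "?S = {v. \<forall>i. 0 \<le> v $ i} \<inter> {v. (\<Sum>i\<in>UNIV. v $ i) = 1}" by auto
  moreover have "closed {v :: real^'q. \<forall>i. 0 \<le> v $ i}"
    by (intro closed_Collect_all closed_Collect_le continuous_intros)
  moreover have "closed {v :: real^'q. (\<Sum>i\<in>UNIV. v $ i) = 1}"
    by (intro closed_Collect_eq continuous_intros)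
  ultimately have "closed ?S" by (simp add: closed_Int)
  moreover have "bounded ?S"
  proof (rule boundedI)
    fix v :: "real^'q" assume v: "v \<in> ?S"
    have "norm v \<le> (\<Sum>i\<in>UNIV. \<bar>v $ i\<bar>)" by (rule norm_le_l1_cart)
    also have "\<dots> = 1" using v by simp
    finally show "norm v \<le> 1" .
  qed
  ultimately have "compact ?S" by (simp add: compact_eq_bounded_closed)
  moreover have "convex ?S"
    by (rule convexI) (auto simp: sum.distrib simp flip: sum_distrib_left)
  moreover have "?S \<noteq> {}"
  proof -
    fix q0 :: 'q
    have "axis q0 1 \<in> ?S" by (simp add: axis_def)
    then show ?thesis by blast
  qed
  moreover have "continuous_on ?S ?f" by (intro continuous_intros)
  moreover have "?f \<in> ?S \<rightarrow> ?S"
  proof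
    fix v :: "real^'q" assume v: "v \<in> ?S"
    have "0 \<le> \<Gamma> $ q $ l" for q l
      using \<Gamma> by (auto simp: pos_stochastic_def intro: order_trans[of 0 c])
    moreover have "(\<Sum>l\<in>UNIV. \<Sum>q\<in>UNIV. v $ q * \<Gamma> $ q $ l) = 1"
      using v \<Gamma> by (subst sum.swap) (simp add: pos_stochastic_def flip: sum_distrib_left)
    ultimately show "?f v \<in> ?S" using v by (auto intro!: sum_nonneg)
  qed
  ultimately obtain v where v: "v \<in> ?S" "?f v = v" by (rule brouwer)
  define a where "a = embed_pmf (\<lambda>q. v $ q)"
  have a: "pmf a q = v $ q" for q
    unfolding a_def using v(1)
    by (intro pmf_embed_pmf) (auto simp: nn_integral_count_space_finite sum_ennreal)
  have "pmf (bind_pmf a (kernel \<Gamma>)) l = pmf a l" for l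
    using arg_cong[OF v(2), of "\<lambda>u. u $ l"] by (simp add: pmf_bind_kernel[OF \<Gamma>] a)
  then show ?thesis by (auto simp: pmf_eq_iff)
qed

lemma stationary_invariant:
  assumes \<Gamma>: "\<Gamma> \<in> pos_stochastic c" "0 < c"
  shows "bind_pmf (stationary \<Gamma>) (kernel \<Gamma>) = stationary \<Gamma>"
proof -
  have "\<exists>!a. bind_pmf a (kernel \<Gamma>) = a"
    using invariant_law_exists[OF \<Gamma>] by (auto intro: invariant_law_unique[OF \<Gamma>])
  then show ?thesis unfolding stationary_def by (rule theI')
qed

lemma pmf_stationary_eq:
  assumes \<Gamma>: "\<Gamma> \<in> pos_stochastic c" "0 < c"
  shows "(\<Sum>q\<in>UNIV. pmf (stationary \<Gamma>) q * \<Gamma> $ q $ l) = pmf (stationary \<Gamma>) l"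
  using pmf_bind_kernel[OF \<Gamma>, of "stationary \<Gamma>" l] by (simp add: stationary_invariant[OF \<Gamma>])

text \<open>
  A stationary probability is an average of entries of \<open>\<Gamma>\<close>.
\<close>
lemma pmf_stationary_ge:
  assumes \<Gamma>: "\<Gamma> \<in> pos_stochastic c" "0 < c"
  shows "c \<le> pmf (stationary \<Gamma>) l"
proof -
  have "c = (\<Sum>q\<in>UNIV. pmf (stationary \<Gamma>) q * c)"
    by (simp add: sum_pmf_eq_1 flip: sum_distrib_right)
  also have "\<dots> \<le> (\<Sum>q\<in>UNIV. pmf (stationary \<Gamma>) q * \<Gamma> $ q $ l)"
    using \<Gamma> by (intro sum_mono mult_left_mono) (auto simp: pos_stochastic_def)
  finally show ?thesis by (simp add: pmf_stationary_eq[OF \<Gamma>])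
qed

text \<open>
  The difference \<open>d\<close> of the two stationary laws satisfies \<open>d = d \<Gamma> + \<beta> (\<Gamma> - \<Gamma>')\<close>, where
  \<open>\<beta>\<close> is the stationary law of \<open>\<Gamma>'\<close>. The first term is contracted, so it can be absorbed on the left.
\<close>
lemma stationary_lipschitz:
  fixes \<Gamma> \<Gamma>' :: "real^'q^'q::finite"
  assumes \<Gamma>: "\<Gamma> \<in> pos_stochastic c" and \<Gamma>': "\<Gamma>' \<in> pos_stochastic c" and c: "0 < c"
  shows "\<bar>pmf (stationary \<Gamma>) q - pmf (stationary \<Gamma>') q\<bar>
           \<le> (\<Sum>l\<in>UNIV. \<Sum>q\<in>UNIV. \<bar>\<Gamma> $ q $ l - \<Gamma>' $ q $ l\<bar>) / (real CARD('q) * c)"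
proof -
  let ?a = "pmf (stationary \<Gamma>)" and ?b = "pmf (stationary \<Gamma>')"
  let ?d = "\<lambda>q. ?a q - ?b q"
  let ?S = "\<Sum>q\<in>UNIV. \<bar>?d q\<bar>"
  let ?G = "\<Sum>l\<in>UNIV. \<Sum>q\<in>UNIV. \<bar>\<Gamma> $ q $ l - \<Gamma>' $ q $ l\<bar>"
  have split: "?d l = (\<Sum>q\<in>UNIV. ?d q * \<Gamma> $ q $ l) + (\<Sum>q\<in>UNIV. ?b q * (\<Gamma> $ q $ l - \<Gamma>' $ q $ l))" for l
    unfolding pmf_stationary_eq[OF \<Gamma> c, of l, symmetric] pmf_stationary_eq[OF \<Gamma>' c, of l, symmetric]
    by (simp add: left_diff_distrib right_diff_distrib sum_subtractf)
  have "?S \<le> (\<Sum>l\<in>UNIV. \<bar>\<Sum>q\<in>UNIV. ?d q * \<Gamma> $ q $ l\<bar> + \<bar>\<Sum>q\<in>UNIV. ?b q * (\<Gamma> $ q $ l - \<Gamma>' $ q $ l)\<bar>)"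
    by (intro sum_mono) (subst split, rule abs_triangle_ineq)
  also have "\<dots> = (\<Sum>l\<in>UNIV. \<bar>\<Sum>q\<in>UNIV. ?d q * \<Gamma> $ q $ l\<bar>)
                   + (\<Sum>l\<in>UNIV. \<bar>\<Sum>q\<in>UNIV. ?b q * (\<Gamma> $ q $ l - \<Gamma>' $ q $ l)\<bar>)"
    by (simp add: sum.distrib)
  also have "\<dots> \<le> (1 - real CARD('q) * c) * ?S + ?G"
  proof (rule add_mono)
    show "(\<Sum>l\<in>UNIV. \<bar>\<Sum>q\<in>UNIV. ?d q * \<Gamma> $ q $ l\<bar>) \<le> (1 - real CARD('q) * c) * ?S"
      by (rule dobrushin_contraction[OF \<Gamma>]) (simp add: sum_subtractf sum_pmf_eq_1)
    show "(\<Sum>l\<in>UNIV. \<bar>\<Sum>q\<in>UNIV. ?b q * (\<Gamma> $ q $ l - \<Gamma>' $ q $ l)\<bar>) \<le> ?G"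
      by (intro sum_mono order_trans[OF sum_abs]) (simp add: abs_mult mult_left_le_one_le pmf_le_1)
  qed
  finally have "real CARD('q) * c * ?S \<le> ?G" by (simp add: algebra_simps)
  then have "?S \<le> ?G / (real CARD('q) * c)" using c by (simp add: field_simps)
  moreover have "\<bar>?d q\<bar> \<le> ?S" by (rule member_le_sum) auto
  ultimately show ?thesis by linarith
qed

lemma continuous_on_stationary:
  assumes "0 < c"
  shows "continuous_on (pos_stochastic c) (\<lambda>\<Gamma> :: real^'q^'q::finite. pmf (stationary \<Gamma>) q)"
  unfolding continuous_on_def
proof
  fix \<Gamma> :: "real^'q^'q" assume \<Gamma>: "\<Gamma> \<in> pos_stochastic c"
  let ?F = "at \<Gamma> within pos_stochastic c"
  let ?e = "\<lambda>\<Gamma>'. (\<Sum>l\<in>UNIV. \<Sum>q\<in>UNIV. \<bar>\<Gamma>' $ q $ l - \<Gamma> $ q $ l\<bar>) / (real CARD('q) * c)"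
  have "(?e \<longlongrightarrow> (\<Sum>l\<in>(UNIV::'q set). \<Sum>q\<in>(UNIV::'q set). \<bar>\<Gamma> $ q $ l - \<Gamma> $ q $ l\<bar>) / (real CARD('q) * c)) ?F"
    using assms by (intro tendsto_intros) auto
  then have "(?e \<longlongrightarrow> 0) ?F" by simp
  moreover have "\<forall>\<^sub>F \<Gamma>' in ?F. norm (pmf (stationary \<Gamma>') q - pmf (stationary \<Gamma>) q) \<le> ?e \<Gamma>'"
    using stationary_lipschitz[OF _ \<Gamma> assms] by (auto simp: eventually_at_filter)
  ultimately have "((\<lambda>\<Gamma>'. pmf (stationary \<Gamma>') q - pmf (stationary \<Gamma>) q) \<longlongrightarrow> 0) ?F"
    by (rule Lim_null_comparison[rotated])
  then show "((\<lambda>\<Gamma>'. pmf (stationary \<Gamma>') q) \<longlongrightarrow> pmf (stationary \<Gamma>) q) ?F"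
    by (simp add: LIM_zero_iff)
qed

lemma continuous_on_pmf_chain:
  assumes "0 < c"
  shows "continuous_on (pos_stochastic c)
    (\<lambda>\<Gamma> :: real^'q^'q::finite. pmf (chain_pmf (stationary \<Gamma>) (\<lambda>_. kernel \<Gamma>) t) w)"
proof (induction t arbitrary: w)
  case 0
  then show ?case by simp
next
  case (Suc t)
  have "continuous_on (pos_stochastic c) (\<lambda>\<Gamma> :: real^'q^'q. pmf (kernel \<Gamma> q) l)" for q l
    by (rule continuous_on_eq[where f = "\<lambda>\<Gamma>. \<Gamma> $ q $ l"])
       (auto intro!: continuous_intros simp: pmf_kernel[OF _ assms])
  then have "continuous_on (pos_stochastic c)
      (\<lambda>\<Gamma> :: real^'q^'q. pmf (if t = 0 then stationary \<Gamma> else kernel \<Gamma> (w t)) (w (Suc t)))"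
    using continuous_on_stationary[OF assms] by (cases "t = 0") auto
  then show ?case unfolding pmf_chain_Suc by (intro continuous_on_mult Suc.IH)
qed

section \<open>Latent labels and graphs\<close>

definition labelings :: "nat \<Rightarrow> nat \<Rightarrow> 'q labels set" where
  "labelings n T = PiE_dflt {1..n} (\<lambda>_. undefined) (\<lambda>_. paths T)"

definition edges :: "nat \<Rightarrow> nat \<Rightarrow> (nat \<times> nat \<times> nat) set" where
  "edges n T = {(t, i, j). t \<in> {1..T} \<and> 1 \<le> i \<and> i < j \<and> j \<le> n}"

text \<open>
  What remains of \<^const>\<open>param_space\<close> without the identifiability conditions. Unlike these conditions, the bounds
  are stable under limits, and they keep all likelihoods positive and continuous.
\<close>
definition bounded_params :: "nat \<Rightarrow> real \<Rightarrow> real \<Rightarrow> 'q::finite param set" where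
  "bounded_params T \<delta> \<zeta> =
     {(\<Gamma>, \<pi>). \<Gamma> \<in> pos_stochastic \<delta> \<and> (\<forall>t\<in>{1..T}. \<forall>q l. \<pi> t $ q $ l \<in> {\<zeta>..1 - \<zeta>})}"

lemma finite_labelings [simp, intro]: "finite (labelings n T :: 'q::finite labels set)"
  unfolding labelings_def by (rule finite_PiE_dflt) auto

lemma finite_edges [simp, intro]: "finite (edges n T)"
  by (rule finite_subset[of _ "{1..T} \<times> {1..n} \<times> {1..n}"]) (auto simp: edges_def)

lemma param_space_subset_bounded: "param_space T \<delta> \<zeta> \<subseteq> bounded_params T \<delta> \<zeta>"
  by (auto simp: param_space_def bounded_params_def pos_stochastic_def)

lemma param_spaceD:
  assumes "\<theta> \<in> param_space T \<delta> \<zeta>"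
  shows "t \<in> {1..T} \<Longrightarrow> transpose (snd \<theta> t) = snd \<theta> t"
    and "t \<in> {1..T} \<Longrightarrow> snd \<theta> t $ q $ l \<in> {\<zeta>..1 - \<zeta>}"
    and "s \<in> {1..T} \<Longrightarrow> t \<in> {1..T} \<Longrightarrow> snd \<theta> s $ q $ q = snd \<theta> t $ q $ q"
    and "t \<in> {1..T} \<Longrightarrow> inj (\<lambda>q. snd \<theta> t $ q $ q)"
    and "(\<Sum>l\<in>UNIV. fst \<theta> $ q $ l) = 1"
    and "fst \<theta> $ q $ l \<in> {\<delta>..1 - \<delta>}"
proof -
  note \<theta> = assms[unfolded param_space_def case_prod_beta mem_Collect_eq]
  have "\<forall>t\<in>{1..T}. transpose (snd \<theta> t) = snd \<theta> t" using \<theta> by (elim conjE)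
  then show "t \<in> {1..T} \<Longrightarrow> transpose (snd \<theta> t) = snd \<theta> t" by (rule bspec)
  have "\<forall>t\<in>{1..T}. \<forall>q l. snd \<theta> t $ q $ l \<in> {\<zeta>..1 - \<zeta>}" using \<theta> by (elim conjE)
  from bspec[OF this, THEN spec, THEN spec]
  show "t \<in> {1..T} \<Longrightarrow> snd \<theta> t $ q $ l \<in> {\<zeta>..1 - \<zeta>}" .
  have "\<forall>s\<in>{1..T}. \<forall>t\<in>{1..T}. \<forall>q. snd \<theta> s $ q $ q = snd \<theta> t $ q $ q" using \<theta> by (elim conjE)
  from bspec[OF bspec[OF this], THEN spec]
  show "s \<in> {1..T} \<Longrightarrow> t \<in> {1..T} \<Longrightarrow> snd \<theta> s $ q $ q = snd \<theta> t $ q $ q" .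
  have "\<forall>t\<in>{1..T}. inj (\<lambda>q. snd \<theta> t $ q $ q)" using \<theta> by (elim conjE)
  then show "t \<in> {1..T} \<Longrightarrow> inj (\<lambda>q. snd \<theta> t $ q $ q)" by (rule bspec)
  have "\<forall>q. (\<Sum>l\<in>UNIV. fst \<theta> $ q $ l) = 1" using \<theta> by (elim conjE)
  then show "(\<Sum>l\<in>UNIV. fst \<theta> $ q $ l) = 1" by (rule spec)
  have "\<forall>q l. fst \<theta> $ q $ l \<in> {\<delta>..1 - \<delta>}" using \<theta> by (elim conjE)
  from this[THEN spec, THEN spec] show "fst \<theta> $ q $ l \<in> {\<delta>..1 - \<delta>}" .
qed

lemma set_Pi_chain_subset_labelings:
  "set_pmf (Pi_pmf {1..n} (\<lambda>_. undefined) (\<lambda>i. chain_pmf (a i) (K i) T)) \<subseteq> labelings n T"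
  using set_chain_subset_paths[of _ _ T] by (fastforce simp: set_Pi_pmf labelings_def PiE_dflt_def)

lemma set_latent_subset_labelings: "set_pmf (latent_law n T \<Gamma>) \<subseteq> labelings n T"
  unfolding latent_law_def by (rule set_Pi_chain_subset_labelings)

lemma labelings_nonempty: "labelings n T \<noteq> {}"
  unfolding labelings_def paths_def by simp

lemma pmf_latent:
  assumes "z \<in> labelings n T"
  shows "pmf (latent_law n T \<Gamma>) z
           = (\<Prod>i\<in>{1..n}. pmf (chain_pmf (stationary \<Gamma>) (\<lambda>_. kernel \<Gamma>) T) (z i))"
  unfolding latent_law_def using assms by (subst pmf_Pi') (auto simp: labelings_def PiE_dflt_def)

lemma pmf_latent_ge:
  assumes \<Gamma>: "\<Gamma> \<in> pos_stochastic c" "0 < c" and z: "z \<in> labelings n T"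
  shows "c ^ (T * n) \<le> pmf (latent_law n T \<Gamma>) z"
proof -
  have "(\<Prod>i\<in>{1..n}. c ^ T) \<le> pmf (latent_law n T \<Gamma>) z"
    unfolding pmf_latent[OF z]
  proof (intro prod_mono conjI)
    fix i assume "i \<in> {1..n}"
    then have "z i \<in> paths T" using z by (auto simp: labelings_def PiE_dflt_def)
    then show "c ^ T \<le> pmf (chain_pmf (stationary \<Gamma>) (\<lambda>_. kernel \<Gamma>) T) (z i)"
      using \<Gamma> pmf_stationary_ge[OF \<Gamma>]
      by (intro pmf_chain_ge) (auto simp: pmf_kernel[OF \<Gamma>] pos_stochastic_def)
  qed (use \<Gamma> in auto)
  then show ?thesis by (simp add: power_mult)
qed

lemma set_graph_law_subset: "set_pmf (graph_law n T \<pi> z) \<subseteq> graph_space n T"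
proof
  fix x assume "x \<in> set_pmf (graph_law n T \<pi> z)"
  then obtain e where e: "x = (\<lambda>t i j. e (t, min i j, max i j))" "\<And>a. a \<notin> edges n T \<Longrightarrow> \<not> e a"
    unfolding graph_law_def edges_def[symmetric]
    by (auto simp: set_Pi_pmf PiE_dflt_def)
  show "x \<in> graph_space n T"
    unfolding graph_space_def
  proof (intro CollectI allI impI)
    fix t i j assume ij: "x t i j"
    then have "(t, min i j, max i j) \<in> edges n T" using e by auto
    then have "t \<in> {1..T}" "1 \<le> min i j" "min i j < max i j" "max i j \<le> n" by (auto simp: edges_def)
    moreover have "x t j i" using ij by (simp add: e(1) min.commute max.commute)
    ultimately show "t \<in> {1..T} \<and> i \<in> {1..n} \<and> j \<in> {1..n} \<and> i \<noteq> j \<and> x t j i" by auto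
  qed
qed

text \<open>
  The symmetrization is injective on edge vectors that vanish off \<^const>\<open>edges\<close>, hence the
  preimage of \<open>x\<close> under it is, up to a null set, the single edge vector read off above the diagonal.
\<close>
lemma pmf_graph_law:
  assumes x: "x \<in> graph_space n T"
  shows "pmf (graph_law n T \<pi> z) x
           = (\<Prod>(t, i, j)\<in>edges n T. pmf (bernoulli_pmf (\<pi> t $ z i t $ z j t)) (x t i j))"
proof -
  let ?P = "Pi_pmf (edges n T) False (\<lambda>(t, i, j). bernoulli_pmf (\<pi> t $ z i t $ z j t))"
  let ?f = "\<lambda>e t i j. e (t, min i j, max i j)"
  let ?e = "\<lambda>(t, i, j). (t, i, j) \<in> edges n T \<and> x t i j"
  have "?f -` {x} \<inter> set_pmf ?P = {?e} \<inter> set_pmf ?P"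
  proof -
    have "e = ?e" if "e \<in> set_pmf ?P" "?f e = x" for e
    proof
      fix a :: "nat \<times> nat \<times> nat"
      obtain t i j where a: "a = (t, i, j)" by (cases a)
      have "\<not> e a" if "a \<notin> edges n T"
        using that \<open>e \<in> set_pmf ?P\<close> unfolding a by (auto simp: set_Pi_pmf PiE_dflt_def)
      moreover have "x t i j = e (t, i, j)" if "a \<in> edges n T"
        using that a \<open>?f e = x\<close> by (auto simp: edges_def)
      ultimately show "e a = ?e a" using a by auto
    qed
    moreover have "?f ?e = x"
    proof (intro ext)
      fix t i j
      have "x t i j = x t j i" using x by (auto simp: graph_space_def)
      moreover have "(t, min i j, max i j) \<in> edges n T" if "x t i j"
        using x that by (fastforce simp: graph_space_def edges_def min_def max_def order_less_le)
      ultimately show "?f ?e t i j = x t i j" by (auto simp: min_def max_def)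
    qed
    ultimately show ?thesis by blast
  qed
  then have "measure_pmf.prob ?P (?f -` {x} \<inter> set_pmf ?P) = measure_pmf.prob ?P ({?e} \<inter> set_pmf ?P)"
    by (rule arg_cong)
  then have "measure_pmf.prob ?P (?f -` {x}) = measure_pmf.prob ?P {?e}"
    by (simp only: measure_Int_set_pmf)
  also have "\<dots> = pmf ?P ?e" by (simp add: pmf.rep_eq)
  also have "\<dots> = (\<Prod>a\<in>edges n T. pmf ((\<lambda>(t, i, j). bernoulli_pmf (\<pi> t $ z i t $ z j t)) a) (?e a))"
    by (rule pmf_Pi') auto
  also have "\<dots> = (\<Prod>(t, i, j)\<in>edges n T. pmf (bernoulli_pmf (\<pi> t $ z i t $ z j t)) (x t i j))"
    by (rule prod.cong) auto
  finally show ?thesis unfolding graph_law_def edges_def[symmetric] pmf_map .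
qed

lemma pmf_bind_map_Pair: "pmf (bind_pmf M (\<lambda>a. map_pmf (Pair a) (f a))) (a, b) = pmf M a * pmf (f a) b"
proof -
  have "pmf (map_pmf (Pair a') (f a')) (a, b) = (if a' = a then pmf (f a) b else 0)" for a'
    using pmf_map_inj'[of "Pair a" "f a" b] by (auto simp: inj_def intro!: pmf_map_outside)
  then have "pmf (bind_pmf M (\<lambda>a. map_pmf (Pair a) (f a))) (a, b)
      = (\<integral>a'. (if a' = a then pmf (f a) b else 0) \<partial>measure_pmf M)"
    by (simp add: pmf_bind)
  also have "\<dots> = (\<Sum>a'\<in>{a}. (if a' = a then pmf (f a) b else 0) * pmf M a')"
    by (rule integral_measure_pmf_real) (auto split: if_splits)
  finally show ?thesis by simp
qed

lemma pmf_joint: "pmf (joint_law n T \<theta>) (z, x) = pmf (latent_law n T (fst \<theta>)) z * pmf (graph_law n T (snd \<theta>) z) x"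
  unfolding joint_law_def by (rule pmf_bind_map_Pair)

definition edge_loglik :: "nat \<Rightarrow> nat \<Rightarrow> (nat \<Rightarrow> real^'q^'q) \<Rightarrow> 'q::finite labels \<Rightarrow> graphs \<Rightarrow> real" where
  "edge_loglik n T \<pi> z x =
     (\<Sum>(t, i, j)\<in>edges n T. ln (pmf (bernoulli_pmf (\<pi> t $ z i t $ z j t)) (x t i j)))"

lemma pmf_bernoulli_bounds:
  assumes "p \<in> {\<zeta>..1 - \<zeta>}" "0 < \<zeta>"
  shows "\<zeta> \<le> pmf (bernoulli_pmf p) b"
  using assms by (cases b) (auto simp: pmf_bernoulli_True pmf_bernoulli_False)

context
  fixes n T :: nat and \<delta> \<zeta> :: real and \<theta> :: "'q::finite param" and x :: graphs
  assumes pos: "0 < \<delta>" "0 < \<zeta>" and \<theta>: "\<theta> \<in> bounded_params T \<delta> \<zeta>" and x: "x \<in> graph_space n T"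
begin

lemma edge_prob_pos:
  "(t, i, j) \<in> edges n T \<Longrightarrow> 0 < pmf (bernoulli_pmf (snd \<theta> t $ z i t $ z j t)) (x t i j)"
  using \<theta> pos by (intro less_le_trans[OF pos(2) pmf_bernoulli_bounds]) (auto simp: bounded_params_def edges_def)

lemma graph_law_pos: "0 < pmf (graph_law n T (snd \<theta>) z) x"
  unfolding pmf_graph_law[OF x] by (rule prod_pos) (use edge_prob_pos in auto)

lemma ln_graph_law: "ln (pmf (graph_law n T (snd \<theta>) z) x) = edge_loglik n T (snd \<theta>) z x"
proof -
  have "pmf (bernoulli_pmf (snd \<theta> t $ z i t $ z j t)) (x t i j) \<noteq> 0" if "(t, i, j) \<in> edges n T" for t i j
    using edge_prob_pos[OF that, of z] by linarith
  then show ?thesis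
    unfolding pmf_graph_law[OF x] edge_loglik_def by (subst ln_prod) (auto simp: case_prod_beta)
qed

lemma latent_pos: "z \<in> labelings n T \<Longrightarrow> 0 < pmf (latent_law n T (fst \<theta>)) z"
  using pmf_latent_ge[of "fst \<theta>" \<delta> z n T] \<theta> pos
  by (auto simp: bounded_params_def intro: less_le_trans[of _ "\<delta> ^ (T * n)"])

lemma joint_pos: "z \<in> labelings n T \<Longrightarrow> 0 < pmf (joint_law n T \<theta>) (z, x)"
  by (simp add: pmf_joint latent_pos graph_law_pos)

lemma ln_joint: "z \<in> labelings n T \<Longrightarrow>
    ln (pmf (joint_law n T \<theta>) (z, x)) = ln (pmf (latent_law n T (fst \<theta>)) z) + edge_loglik n T (snd \<theta>) z x"
  unfolding pmf_joint
  by (subst ln_mult_pos) (simp_all add: ln_graph_law latent_pos graph_law_pos)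

text \<open>
  The prior of any labelling costs at most \<open>n T ln (1 / \<delta>)\<close>. This is of order \<open>n\<close>, below the order
  \<open>n\<close> to the power \<open>3/2\<close> of the fluctuations of the log-likelihood.
\<close>
lemma ln_joint_ge: "z \<in> labelings n T \<Longrightarrow>
    real (T * n) * ln \<delta> + edge_loglik n T (snd \<theta>) z x \<le> ln (pmf (joint_law n T \<theta>) (z, x))"
proof -
  assume z: "z \<in> labelings n T"
  have "fst \<theta> \<in> pos_stochastic \<delta>" using \<theta> by (auto simp: bounded_params_def)
  from pmf_latent_ge[OF this pos(1) z] have "ln (\<delta> ^ (T * n)) \<le> ln (pmf (latent_law n T (fst \<theta>)) z)"
    using pos by (subst ln_le_cancel_iff) (auto simp: latent_pos z)
  then show ?thesis using pos by (simp add: ln_joint[OF z] ln_realpow)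
qed

lemma obs_pos: "0 < pmf (obs_law n T \<theta>) x"
proof -
  obtain z :: "'q labels" where "z \<in> labelings n T" using labelings_nonempty by blast
  then have "(z, x) \<in> set_pmf (joint_law n T \<theta>)" using joint_pos[of z] by (auto simp: set_pmf_iff)
  then have "x \<in> set_pmf (obs_law n T \<theta>)" unfolding obs_law_def by force
  then show ?thesis by (simp add: pmf_positive)
qed

lemma pmf_posterior: "pmf (posterior n T \<theta> x) z = pmf (joint_law n T \<theta>) (z, x) / pmf (obs_law n T \<theta>) x"
proof -
  let ?J = "joint_law n T \<theta>" and ?A = "{zx. snd zx = x}"
  have ne: "set_pmf ?J \<inter> ?A \<noteq> {}"
    using obs_pos by (auto simp: obs_law_def pmf_positive_iff)
  have "fst -` {z} \<inter> set_pmf (cond_pmf ?J ?A) = {(z, x)} \<inter> set_pmf (cond_pmf ?J ?A)"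
    by (auto simp: set_cond_pmf[OF ne])
  then have "measure_pmf.prob (cond_pmf ?J ?A) (fst -` {z} \<inter> set_pmf (cond_pmf ?J ?A))
      = measure_pmf.prob (cond_pmf ?J ?A) ({(z, x)} \<inter> set_pmf (cond_pmf ?J ?A))"
    by (rule arg_cong)
  then have "pmf (posterior n T \<theta> x) z = pmf (cond_pmf ?J ?A) (z, x)"
    unfolding posterior_def pmf_map by (simp only: measure_Int_set_pmf pmf.rep_eq)
  also have "\<dots> = pmf ?J (z, x) / measure_pmf.prob ?J ?A" by (subst pmf_cond[OF ne]) simp
  also have "?A = snd -` {x}" by auto
  also have "measure_pmf.prob ?J (snd -` {x}) = pmf (obs_law n T \<theta>) x"
    unfolding obs_law_def pmf_map ..
  finally show ?thesis .
qed

end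

section \<open>The variational objective\<close>

text \<open>
  The density of \<open>q\<close> with respect to \<open>p\<close> is the quotient of the two mass functions. Taking
  \<^term>\<open>measure_pmf p\<close> as the base measure avoids the counting measure, which is not \<open>\<sigma>\<close>-finite on an uncountable
  type.
\<close>
lemma KL_divergence_measure_pmf:
  assumes b: "1 < b" and sub: "set_pmf q \<subseteq> set_pmf p" and A: "finite A" "set_pmf q \<subseteq> A"
  shows "KL_divergence b (measure_pmf p) (measure_pmf q) = (\<Sum>z\<in>A. pmf q z * log b (pmf q z / pmf p z))"
proof -
  let ?f = "\<lambda>z. pmf q z / pmf p z"
  have pq: "pmf p z * ?f z = pmf q z" for z
    using sub by (cases "z \<in> set_pmf q") (auto simp: set_pmf_iff)
  have "density (measure_pmf p) (\<lambda>z. ennreal (?f z))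
      = density (count_space UNIV) (\<lambda>z. ennreal (pmf p z) * ennreal (?f z))"
    unfolding measure_pmf_eq_density[of p] by (rule density_density_eq) auto
  also have "\<dots> = measure_pmf q"
    unfolding measure_pmf_eq_density[of q] by (simp only: pq pmf_nonneg divide_nonneg_nonneg flip: ennreal_mult)
  finally have "KL_divergence b (measure_pmf p) (measure_pmf q)
      = (\<integral>z. ?f z * log b (?f z) \<partial>measure_pmf p)"
    using sigma_finite_measure.KL_density[OF measure_pmf.sigma_finite_measure_axioms b, of ?f p] by simp
  also have "\<dots> = (\<Sum>z\<in>A. ?f z * log b (?f z) * pmf p z)"
    using A by (intro integral_measure_pmf_real) (auto simp: set_pmf_iff subset_iff)
  also have "\<dots> = (\<Sum>z\<in>A. pmf q z * log b (?f z))"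
  proof (rule sum.cong[OF refl])
    fix z
    show "?f z * log b (?f z) * pmf p z = pmf q z * log b (?f z)"
      by (subst pq[of z, symmetric]) (simp only: mult_ac)
  qed
  finally show ?thesis .
qed

lemma map_chain_Suc:
  assumes "\<And>w q. f (w(Suc t := q)) = f w"
  shows "map_pmf f (chain_pmf a K (Suc t)) = map_pmf f (chain_pmf a K t)"
  by (simp add: map_bind_pmf pmf.map_comp o_def assms map_pmf_const)
     (simp add: map_pmf_def)

text \<open>
  A Markov law is determined by its one-time and two-time marginals: the pair law at times \<open>T\<close> and
  \<open>Suc T\<close> fixes the transition law from every state that is reached with positive probability, and the transitions
  from the other states do not influence the law of the chain.
\<close>
lemma chain_pmf_eqI:
  assumes "\<And>t. t \<in> {1..T} \<Longrightarrow> map_pmf (\<lambda>w. w t) (chain_pmf a K T) = map_pmf (\<lambda>w. w t) (chain_pmf a' K' T)"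
    and "\<And>t. t \<in> {1..<T} \<Longrightarrow> map_pmf (\<lambda>w. (w t, w (t + 1))) (chain_pmf a K T)
            = map_pmf (\<lambda>w. (w t, w (t + 1))) (chain_pmf a' K' T)"
  shows "chain_pmf a K T = chain_pmf a' K' T"
  using assms
proof (induction T)
  case 0
  then show ?case by simp
next
  case (Suc T)
  have IH: "chain_pmf a K T = chain_pmf a' K' T"
  proof (rule Suc.IH)
    fix t assume t: "t \<in> {1..T}"
    have "map_pmf (\<lambda>w. w t) (chain_pmf a K (Suc T)) = map_pmf (\<lambda>w. w t) (chain_pmf a K T)" for a :: "'a pmf" and K
      using t by (intro map_chain_Suc) auto
    then show "map_pmf (\<lambda>w. w t) (chain_pmf a K T) = map_pmf (\<lambda>w. w t) (chain_pmf a' K' T)"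
      using Suc.prems(1)[of t] t by (simp del: chain_pmf.simps)
  next
    fix t assume t: "t \<in> {1..<T}"
    have "map_pmf (\<lambda>w. (w t, w (t + 1))) (chain_pmf a K (Suc T))
        = map_pmf (\<lambda>w. (w t, w (t + 1))) (chain_pmf a K T)" for a :: "'a pmf" and K
      using t by (intro map_chain_Suc) auto
    then show "map_pmf (\<lambda>w. (w t, w (t + 1))) (chain_pmf a K T) = map_pmf (\<lambda>w. (w t, w (t + 1))) (chain_pmf a' K' T)"
      using Suc.prems(2)[of t] t by (simp del: chain_pmf.simps)
  qed
  show ?case
  proof (cases "T = 0")
    case True
    have "map_pmf (\<lambda>w. w 1) (chain_pmf a K (Suc 0)) = a" for a :: "'a pmf" and K
      by (simp add: bind_return_pmf pmf.map_comp o_def)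
    then have "a = a'" using Suc.prems(1)[of 1] True by (simp del: chain_pmf.simps)
    then show ?thesis using True by (simp add: bind_return_pmf)
  next
    case False
    have pair: "map_pmf (\<lambda>w. (w T, w (Suc T))) (chain_pmf a K (Suc T))
        = bind_pmf (map_pmf (\<lambda>w. w T) (chain_pmf a K T)) (\<lambda>s. map_pmf (Pair s) (K T s))" for a :: "'a pmf" and K
      using False by (simp add: map_bind_pmf bind_map_pmf pmf.map_comp o_def)
    let ?M = "map_pmf (\<lambda>w. w T) (chain_pmf a K T)"
    have "bind_pmf ?M (\<lambda>s. map_pmf (Pair s) (K T s)) = bind_pmf ?M (\<lambda>s. map_pmf (Pair s) (K' T s))"
      using Suc.prems(2)[of T] False by (simp add: pair IH del: chain_pmf.simps)
    from arg_cong[OF this, of "\<lambda>p. pmf p (s, l)" for s l]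
    have eq: "pmf ?M s * pmf (K T s) l = pmf ?M s * pmf (K' T s) l" for s l
      unfolding pmf_bind_map_Pair .
    have "K T s = K' T s" if "s \<in> set_pmf ?M" for s
    proof (rule pmf_eqI)
      have "pmf ?M s \<noteq> 0" using that by (simp only: pmf_eq_0_set_pmf not_not)
      from iffD1[OF mult_left_cancel[OF this] eq]
      show "pmf (K T s) l = pmf (K' T s) l" for l .
    qed
    then have "K T (w T) = K' T (w T)" if "w \<in> set_pmf (chain_pmf a K T)" for w
      using that by auto
    then show ?thesis using False IH[symmetric] by (auto intro!: bind_pmf_cong)
  qed
qed

text \<open>
  This makes the definite description in \<^const>\<open>var_law\<close> meaningful.
\<close>
lemma var_law_unique:
  assumes R: "is_var_law n T chi R" and R': "is_var_law n T chi R'"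
  shows "R = R'"
proof -
  obtain \<tau> \<eta> where chi: "chi = (\<tau>, \<eta>)" by (cases chi)
  from R obtain a K where aK: "R = Pi_pmf {1..n} (\<lambda>_. undefined) (\<lambda>i. chain_pmf (a i) (K i) T)"
    unfolding is_var_law_def chi by auto
  from R' obtain a' K' where aK': "R' = Pi_pmf {1..n} (\<lambda>_. undefined) (\<lambda>i. chain_pmf (a' i) (K' i) T)"
    unfolding is_var_law_def chi by auto
  have "chain_pmf (a i) (K i) T = chain_pmf (a' i) (K' i) T" if i: "i \<in> {1..n}" for i
  proof (rule chain_pmf_eqI)
    have c: "map_pmf (\<lambda>z. z i) R = chain_pmf (a i) (K i) T" "map_pmf (\<lambda>z. z i) R' = chain_pmf (a' i) (K' i) T"
      using i by (simp_all add: aK aK' Pi_pmf_component)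
    have mar: "measure_pmf.prob R {z. z i t = q} = measure_pmf.prob R' {z. z i t = q}" if "t \<in> {1..T}" for t q
      using R R' i that unfolding is_var_law_def chi by auto
    have pair: "measure_pmf.prob R {z. z i t = q \<and> z i (t + 1) = l} = measure_pmf.prob R' {z. z i t = q \<and> z i (t + 1) = l}"
      if "t \<in> {1..<T}" for t q l
      using R R' i that unfolding is_var_law_def chi by auto
    show "map_pmf (\<lambda>w. w t) (chain_pmf (a i) (K i) T) = map_pmf (\<lambda>w. w t) (chain_pmf (a' i) (K' i) T)"
      if "t \<in> {1..T}" for t
      using mar[OF that] unfolding c[symmetric] pmf.map_comp
      by (auto simp: pmf_eq_iff pmf_map vimage_def)
    show "map_pmf (\<lambda>w. (w t, w (t + 1))) (chain_pmf (a i) (K i) T)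
        = map_pmf (\<lambda>w. (w t, w (t + 1))) (chain_pmf (a' i) (K' i) T)"
      if "t \<in> {1..<T}" for t
      using pair[OF that] unfolding c[symmetric] pmf.map_comp
      by (auto simp: pmf_eq_iff pmf_map vimage_def)
  qed
  then show ?thesis unfolding aK aK' by (intro Pi_pmf_cong) auto
qed

lemma var_law_eq: "is_var_law n T chi R \<Longrightarrow> var_law n T chi = R"
  unfolding var_law_def by (rule the_equality) (auto intro: var_law_unique)

lemma set_var_law_subset: "is_var_law n T chi R \<Longrightarrow> set_pmf R \<subseteq> labelings n T"
  using set_Pi_chain_subset_labelings by (fastforce simp: is_var_law_def split: prod.splits)

text \<open>
  A deterministic labelling is a Markov chain with deterministic transitions, so point masses belong to the
  variational family. They give the lower bound on the variational objective.
\<close>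
lemma point_mass_var_law:
  assumes z: "z \<in> labelings n T"
  shows "\<exists>chi. is_var_law n T chi (return_pmf z)"
proof -
  have chain: "chain_pmf (return_pmf (w 1)) (\<lambda>t _. return_pmf (w (t + 1))) t = return_pmf (\<lambda>s. if s \<in> {1..t} then w s else undefined)"
    for w :: "nat \<Rightarrow> 'a" and t
    by (induction t) (auto simp: bind_return_pmf fun_eq_iff)
  have "chain_pmf (return_pmf (z i 1)) (\<lambda>t _. return_pmf (z i (t + 1))) T = return_pmf (z i)" if "i \<in> {1..n}" for i
  proof -
    have "z i \<in> paths T" using z that by (auto simp: labelings_def PiE_dflt_def)
    then have "(\<lambda>s. if s \<in> {1..T} then z i s else undefined) = z i" by (auto simp: paths_iff fun_eq_iff)
    then show ?thesis by (simp only: chain)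
  qed
  then have "Pi_pmf {1..n} (\<lambda>_. undefined) (\<lambda>i. chain_pmf (return_pmf (z i 1)) (\<lambda>t _. return_pmf (z i (t + 1))) T)
      = Pi_pmf {1..n} (\<lambda>_. undefined) (\<lambda>i. return_pmf (z i))"
    by (intro Pi_pmf_cong) auto
  also have "\<dots> = return_pmf (\<lambda>i. if i \<in> {1..n} then z i else (\<lambda>_. undefined))" by simp
  also have "(\<lambda>i. if i \<in> {1..n} then z i else (\<lambda>_. undefined)) = z"
    using z by (auto simp: labelings_def PiE_dflt_def fun_eq_iff)
  finally have "\<exists>a K. return_pmf z = Pi_pmf {1..n} (\<lambda>_. undefined) (\<lambda>i. chain_pmf (a i) (K i) T)"
    by (intro exI[of _ "\<lambda>i. return_pmf (z i 1)"] exI[of _ "\<lambda>i t _. return_pmf (z i (t + 1))"]) (rule sym)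
  then show ?thesis
    by (intro exI[of _ "(\<lambda>t i q. measure_pmf.prob (return_pmf z) {z. z i t = q},
        \<lambda>t i q l. measure_pmf.prob (return_pmf z) {z. z i t = q \<and> z i (t + 1) = l})"])
       (auto simp: is_var_law_def)
qed

text \<open>
  The evidence lower bound in its usual form, expected complete log-likelihood plus entropy. The entropy does not
  depend on \<open>\<theta>\<close>.
\<close>
lemma elbo_eq:
  assumes pos: "0 < \<delta>" "0 < \<zeta>" and \<theta>: "\<theta> \<in> bounded_params T \<delta> \<zeta>" and x: "x \<in> graph_space n T"
    and R: "is_var_law n T chi R"
  shows "elbo n T x chi \<theta> = (\<Sum>z\<in>labelings n T. pmf R z * (ln (pmf (joint_law n T \<theta>) (z, x)) - ln (pmf R z)))"
proof -
  note hyps = pos \<theta> x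
  let ?L = "labelings n T :: 'a labels set"
  have R_sub: "set_pmf R \<subseteq> ?L" by (rule set_var_law_subset[OF R])
  have "set_pmf R \<subseteq> set_pmf (posterior n T \<theta> x)"
    using R_sub joint_pos[OF hyps] obs_pos[OF hyps] by (force simp: set_pmf_iff pmf_posterior[OF hyps])
  then have "KL_divergence (exp 1) (measure_pmf (posterior n T \<theta> x)) (measure_pmf R)
      = (\<Sum>z\<in>?L. pmf R z * log (exp 1) (pmf R z / pmf (posterior n T \<theta> x) z))"
    by (intro KL_divergence_measure_pmf R_sub) auto
  also have "\<dots> = (\<Sum>z\<in>?L. pmf R z * (ln (pmf R z) - ln (pmf (joint_law n T \<theta>) (z, x)) + log_lik n T x \<theta>))"
  proof (rule sum.cong[OF refl])
    fix z assume z: "z \<in> ?L"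
    show "pmf R z * log (exp 1) (pmf R z / pmf (posterior n T \<theta> x) z)
        = pmf R z * (ln (pmf R z) - ln (pmf (joint_law n T \<theta>) (z, x)) + log_lik n T x \<theta>)"
      using joint_pos[OF hyps z] obs_pos[OF hyps]
      by (cases "pmf R z = 0")
         (auto simp: pmf_posterior[OF hyps] log_def log_lik_def ln_div ln_mult pmf_nonneg less_le)
  qed
  also have "\<dots> = log_lik n T x \<theta> * (\<Sum>z\<in>?L. pmf R z)
      - (\<Sum>z\<in>?L. pmf R z * (ln (pmf (joint_law n T \<theta>) (z, x)) - ln (pmf R z)))"
    by (simp add: algebra_simps sum.distrib sum_subtractf sum_distrib_left)
  also have "(\<Sum>z\<in>?L. pmf R z) = 1" using R_sub by (intro sum_pmf_eq_1) auto
  finally show ?thesis unfolding elbo_def var_law_eq[OF R] by simp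
qed

text \<open>
  The criterion that the variational estimator maximizes over the parameter space.
\<close>
definition profile :: "nat \<Rightarrow> nat \<Rightarrow> graphs \<Rightarrow> ('q::finite param \<Rightarrow> 'q vparam) \<Rightarrow> 'q param \<Rightarrow> real" where
  "profile n T x chihat \<theta> = elbo n T x (chihat \<theta>) \<theta>"

context
  fixes n T :: nat and \<delta> \<zeta> :: real and x :: graphs and chihat :: "'q::finite param \<Rightarrow> 'q vparam"
  assumes pos: "0 < \<delta>" "0 < \<zeta>" and x: "x \<in> graph_space n T"
    and chihat: "\<And>\<theta>. \<theta> \<in> param_space T \<delta> \<zeta> \<Longrightarrow> is_chi_hat n T x \<theta> (chihat \<theta>)"
begin

lemma chihat_var_law: "\<theta> \<in> param_space T \<delta> \<zeta> \<Longrightarrow> \<exists>R. is_var_law n T (chihat \<theta>) R"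
proof -
  assume "\<theta> \<in> param_space T \<delta> \<zeta>"
  from chihat[OF this] have "chihat \<theta> \<in> var_space n T"
    unfolding is_chi_hat_def is_arg_max_linorder by (rule conjunct1)
  then show ?thesis unfolding var_space_def by (rule CollectD)
qed

lemma elbo_le_profile:
  "\<theta> \<in> param_space T \<delta> \<zeta> \<Longrightarrow> is_var_law n T chi R \<Longrightarrow> elbo n T x chi \<theta> \<le> profile n T x chihat \<theta>"
proof -
  assume "\<theta> \<in> param_space T \<delta> \<zeta>" and R: "is_var_law n T chi R"
  from chihat[OF this(1)]
  have "\<forall>chi'. chi' \<in> var_space n T \<longrightarrow> elbo n T x chi' \<theta> \<le> elbo n T x (chihat \<theta>) \<theta>"
    unfolding is_chi_hat_def is_arg_max_linorder by (rule conjunct2)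
  moreover have "chi \<in> var_space n T" unfolding var_space_def using R by blast
  ultimately show ?thesis unfolding profile_def by blast
qed

text \<open>
  The point mass at \<open>z\<close> as a competitor.
\<close>
lemma profile_ge:
  assumes \<theta>: "\<theta> \<in> param_space T \<delta> \<zeta>" and z: "z \<in> labelings n T"
  shows "real (T * n) * ln \<delta> + edge_loglik n T (snd \<theta>) z x \<le> profile n T x chihat \<theta>"
proof -
  obtain chi where chi: "is_var_law n T chi (return_pmf z)" using point_mass_var_law[OF z] by blast
  have b: "\<theta> \<in> bounded_params T \<delta> \<zeta>" using \<theta> param_space_subset_bounded by blast
  have "elbo n T x chi \<theta> = (\<Sum>z'\<in>labelings n T. if z' = z then ln (pmf (joint_law n T \<theta>) (z, x)) else 0)"
    unfolding elbo_eq[OF pos b x chi] by (rule sum.cong) (simp_all split: split_indicator)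
  also have "\<dots> = ln (pmf (joint_law n T \<theta>) (z, x))" using z by simp
  finally show ?thesis
    using elbo_le_profile[OF \<theta> chi] ln_joint_ge[OF pos b x z] by linarith
qed

text \<open>
  The expected log prior plus the entropy is minus a Kullback--Leibler divergence, hence nonpositive
  (by \<open>ln u \<le> u - 1\<close>), and an average of conditional log-likelihoods is at most their maximum.
\<close>
lemma profile_le:
  assumes \<theta>: "\<theta> \<in> param_space T \<delta> \<zeta>"
  shows "\<exists>z\<in>labelings n T. profile n T x chihat \<theta> \<le> edge_loglik n T (snd \<theta>) z x"
proof -
  let ?L = "labelings n T :: 'q labels set" and ?e = "\<lambda>z. edge_loglik n T (snd \<theta>) z x"
  have b: "\<theta> \<in> bounded_params T \<delta> \<zeta>" using \<theta> param_space_subset_bounded by blast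
  obtain R where R: "is_var_law n T (chihat \<theta>) R" using chihat_var_law[OF \<theta>] by blast
  have R1: "(\<Sum>z\<in>?L. pmf R z) = 1" using set_var_law_subset[OF R] by (intro sum_pmf_eq_1) auto
  have ne: "?e ` ?L \<noteq> {}" using labelings_nonempty[of n T, where 'a = 'q] by (simp only: image_is_empty) simp
  have "Max (?e ` ?L) \<in> ?e ` ?L" by (rule Max_in[OF _ ne]) simp
  then obtain z where z: "Max (?e ` ?L) = ?e z" "z \<in> ?L" by (rule imageE)
  have zmax: "?e z' \<le> ?e z" if "z' \<in> ?L" for z'
    unfolding z(1)[symmetric] using that by (intro Max_ge) auto
  have "profile n T x chihat \<theta> \<le> (\<Sum>z'\<in>?L. pmf (latent_law n T (fst \<theta>)) z' - pmf R z' + pmf R z' * ?e z)"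
    unfolding profile_def elbo_eq[OF pos b x R]
  proof (rule sum_mono)
    fix z' assume z': "z' \<in> ?L"
    let ?l = "pmf (latent_law n T (fst \<theta>)) z'"
    have l: "0 < ?l" by (rule latent_pos[OF pos b x z'])
    have "pmf R z' * (ln ?l - ln (pmf R z')) \<le> ?l - pmf R z'"
    proof (cases "pmf R z' = 0")
      case False
      then have r: "0 < pmf R z'" using pmf_nonneg[of R z'] by linarith
      have "ln (?l / pmf R z') \<le> ?l / pmf R z' - 1" using l r by (intro ln_le_minus_one) auto
      then have "pmf R z' * (ln ?l - ln (pmf R z')) \<le> pmf R z' * (?l / pmf R z' - 1)"
        using l r by (intro mult_left_mono) (auto simp: ln_div)
      also have "\<dots> = ?l - pmf R z'" using r by (simp add: right_diff_distrib)
      finally show ?thesis .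
    qed (use l in simp)
    moreover have "pmf R z' * ?e z' \<le> pmf R z' * ?e z"
      by (intro mult_left_mono zmax[OF z']) simp
    ultimately show "pmf R z' * (ln (pmf (joint_law n T \<theta>) (z', x)) - ln (pmf R z'))
        \<le> ?l - pmf R z' + pmf R z' * ?e z"
      unfolding ln_joint[OF pos b x z'] by (simp add: algebra_simps)
  qed
  also have "\<dots> = (\<Sum>z'\<in>?L. pmf (latent_law n T (fst \<theta>)) z') - 1 + ?e z"
    by (simp add: sum.distrib sum_subtractf R1 flip: sum_distrib_right)
  also have "(\<Sum>z'\<in>?L. pmf (latent_law n T (fst \<theta>)) z') = 1"
    by (intro sum_pmf_eq_1) (use set_latent_subset_labelings in auto)
  finally have "profile n T x chihat \<theta> \<le> ?e z" by simp
  then show ?thesis using z(2) by blast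
qed

text \<open>
  The maximizing law at \<open>\<theta>\<close> is a competitor at \<open>\<theta>'\<close>, and the two objective values then
  differ only in the complete log-likelihoods. So the criterion inherits their continuity, although
  \<open>chihat\<close> itself may depend on \<open>\<theta>\<close> discontinuously.
\<close>
lemma profile_diff_le:
  assumes \<theta>: "\<theta> \<in> param_space T \<delta> \<zeta>" and \<theta>': "\<theta>' \<in> param_space T \<delta> \<zeta>"
  shows "profile n T x chihat \<theta> - profile n T x chihat \<theta>'
    \<le> (\<Sum>z\<in>labelings n T. \<bar>ln (pmf (joint_law n T \<theta>) (z, x)) - ln (pmf (joint_law n T \<theta>') (z, x))\<bar>)"
proof -
  have b: "\<theta> \<in> bounded_params T \<delta> \<zeta>" "\<theta>' \<in> bounded_params T \<delta> \<zeta>"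
    using \<theta> \<theta>' param_space_subset_bounded by blast+
  obtain R where R: "is_var_law n T (chihat \<theta>) R" using chihat_var_law[OF \<theta>] by blast
  have "profile n T x chihat \<theta> - profile n T x chihat \<theta>' \<le> elbo n T x (chihat \<theta>) \<theta> - elbo n T x (chihat \<theta>) \<theta>'"
    using elbo_le_profile[OF \<theta>' R] by (simp add: profile_def)
  also have "\<dots> = (\<Sum>z\<in>labelings n T. pmf R z * (ln (pmf (joint_law n T \<theta>) (z, x)) - ln (pmf (joint_law n T \<theta>') (z, x))))"
    unfolding elbo_eq[OF pos b(1) x R] elbo_eq[OF pos b(2) x R] sum_subtractf[symmetric]
    by (rule sum.cong) (auto simp: algebra_simps)
  also have "\<dots> \<le> (\<Sum>z\<in>labelings n T. \<bar>ln (pmf (joint_law n T \<theta>) (z, x)) - ln (pmf (joint_law n T \<theta>') (z, x))\<bar>)"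
  proof (rule sum_mono)
    fix z :: "'q labels"
    let ?u = "ln (pmf (joint_law n T \<theta>) (z, x)) - ln (pmf (joint_law n T \<theta>') (z, x))"
    have "pmf R z * ?u \<le> pmf R z * \<bar>?u\<bar>" by (intro mult_left_mono) auto
    also have "\<dots> \<le> \<bar>?u\<bar>" by (intro mult_left_le_one_le) (auto simp: pmf_le_1)
    finally show "pmf R z * ?u \<le> \<bar>?u\<bar>" .
  qed
  finally show ?thesis .
qed

end

section \<open>From likelihood gap to estimation error\<close>

text \<open>
  Each unordered pair is counted once, with its smaller node in \<open>B\<close>.
\<close>
definition pairs :: "nat set \<Rightarrow> nat set \<Rightarrow> (nat \<times> nat) set" where
  "pairs B C = {(i, j). i \<in> B \<and> j \<in> C \<and> i < j}"

lemma finite_pairs [simp, intro]: "finite B \<Longrightarrow> finite C \<Longrightarrow> finite (pairs B C)"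
  by (rule finite_subset[of _ "B \<times> C"]) (auto simp: pairs_def)

lemma edges_eq_Times: "edges n T = {1..T} \<times> pairs {1..n} {1..n}"
  by (auto simp: edges_def pairs_def)

text \<open>
  The divergence of two Bernoulli laws dominates their squared Hellinger distance, because
  \<open>ln u \<le> u - 1\<close> at the square root of the likelihood ratio. That distance dominates the squared
  difference of the parameters, since \<open>sqrt p + sqrt q \<le> 2\<close>.
\<close>
lemma bernoulli_kl_ge:
  fixes p q :: real
  assumes "0 < p" "p < 1" "0 < q" "q < 1"
  shows "(p - q)\<^sup>2 / 4 \<le> p * (ln p - ln q) + (1 - p) * (ln (1 - p) - ln (1 - q))"
proof -
  \<comment> \<open>over the two outcomes, the left-hand sides add up to twice the defect of the Hellinger affinity from 1\<close>
  have hellinger: "2 * (a - sqrt a * sqrt b) \<le> a * (ln a - ln b)" if "0 < a" "0 < b" for a b :: real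
  proof -
    define r where "r = sqrt b / sqrt a"
    have s: "0 < sqrt a" "0 < sqrt b" using that by auto
    have "ln r \<le> r - 1" using s by (intro ln_le_minus_one) (auto simp: r_def)
    moreover have "ln r = (ln b - ln a) / 2"
      using that s by (simp add: r_def ln_divide_pos ln_sqrt diff_divide_distrib)
    ultimately have "2 * (1 - r) \<le> ln a - ln b" by simp
    then have "a * (2 * (1 - r)) \<le> a * (ln a - ln b)" using that by (intro mult_left_mono) auto
    moreover have "a * r = sqrt a * sqrt b"
      using that s by (simp add: r_def field_simps)
    moreover have "a * (2 * (1 - r)) = 2 * (a - a * r)" by (simp add: algebra_simps)
    ultimately show ?thesis by simp
  qed
  have "(p - q)\<^sup>2 = (sqrt p - sqrt q)\<^sup>2 * (sqrt p + sqrt q)\<^sup>2"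
    using assms by (simp add: algebra_simps flip: power_mult_distrib) 
  also have "\<dots> \<le> (sqrt p - sqrt q)\<^sup>2 * 2\<^sup>2"
  proof (intro mult_left_mono power_mono)
    have "sqrt p \<le> 1" "sqrt q \<le> 1" using assms by auto
    then show "sqrt p + sqrt q \<le> 2" by linarith
  qed (use assms in auto)
  finally have "(p - q)\<^sup>2 / 4 \<le> (sqrt p - sqrt q)\<^sup>2" by simp
  also have "\<dots> = p + q - 2 * (sqrt p * sqrt q)"
    using assms by (simp add: power2_diff)
  also have "\<dots> \<le> 2 * (p - sqrt p * sqrt q) + 2 * ((1 - p) - sqrt (1 - p) * sqrt (1 - q))"
  proof -
    have "0 \<le> (sqrt (1 - p) - sqrt (1 - q))\<^sup>2" by simp
    also have "\<dots> = (1 - p) + (1 - q) - 2 * (sqrt (1 - p) * sqrt (1 - q))"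
      using assms by (simp add: power2_diff)
    finally show ?thesis by simp
  qed
  also have "\<dots> \<le> p * (ln p - ln q) + (1 - p) * (ln (1 - p) - ln (1 - q))"
    using assms by (intro add_mono hellinger) auto
  finally show ?thesis .
qed

lemma abs_logit_le:
  fixes p \<zeta> :: real
  assumes "p \<in> {\<zeta>..1 - \<zeta>}" "0 < \<zeta>"
  shows "\<bar>ln p - ln (1 - p)\<bar> \<le> - ln \<zeta>"
proof -
  have "\<zeta> \<le> p" "p \<le> 1 - \<zeta>" using assms by auto
  have "0 < p" using \<open>\<zeta> \<le> p\<close> assms(2) by linarith
  have "p < 1" using \<open>p \<le> 1 - \<zeta>\<close> assms(2) by linarith
  have "ln \<zeta> \<le> ln p" "ln \<zeta> \<le> ln (1 - p)" "ln p \<le> 0" "ln (1 - p) \<le> 0"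
    using assms \<open>0 < p\<close> \<open>p < 1\<close> by auto
  then show ?thesis by linarith
qed

text \<open>
  A weight that depends on a pair only through the labels of its ends is constant on the \<open>Q\<^sup>2\<close> blocks
  cut out by the labelling. Control of the sums over all blocks therefore controls the weighted sum for every
  labelling at once.
\<close>
lemma block_weighted_sum_le:
  fixes \<xi> :: "nat \<Rightarrow> nat \<Rightarrow> real" and f :: "'q::finite \<Rightarrow> 'q \<Rightarrow> real"
  assumes \<xi>: "\<And>B C. B \<subseteq> {1..n} \<Longrightarrow> C \<subseteq> {1..n} \<Longrightarrow> \<bar>\<Sum>(i, j)\<in>pairs B C. \<xi> i j\<bar> \<le> s"
    and f: "\<And>q l. \<bar>f q l\<bar> \<le> L"
  shows "\<bar>\<Sum>(i, j)\<in>pairs {1..n} {1..n}. \<xi> i j * f (w i) (w j)\<bar> \<le> (real CARD('q))\<^sup>2 * (L * s)"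
proof -
  let ?P = "pairs {1..n} {1..n}"
  let ?B = "\<lambda>q. {i \<in> {1..n}. w i = q}"
  have "L \<ge> 0" using f[of undefined undefined] by linarith
  have "(\<Sum>(i, j)\<in>?P. \<xi> i j * f (w i) (w j))
      = (\<Sum>a\<in>?P. \<Sum>ql\<in>UNIV. if (w (fst a), w (snd a)) = ql then \<xi> (fst a) (snd a) * f (fst ql) (snd ql) else 0)"
    by (rule sum.cong) (auto simp: case_prod_beta)
  also have "\<dots> = (\<Sum>ql\<in>UNIV. \<Sum>a\<in>?P. if (w (fst a), w (snd a)) = ql then \<xi> (fst a) (snd a) * f (fst ql) (snd ql) else 0)"
    by (rule sum.swap)
  also have "\<dots> = (\<Sum>ql\<in>UNIV. f (fst ql) (snd ql) * (\<Sum>(i, j)\<in>pairs (?B (fst ql)) (?B (snd ql)). \<xi> i j))"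
  proof (rule sum.cong[OF refl])
    fix ql :: "'q \<times> 'q"
    have "pairs (?B (fst ql)) (?B (snd ql)) = {a \<in> ?P. (w (fst a), w (snd a)) = ql}"
      by (cases ql) (auto simp: pairs_def)
    note this[symmetric]
    moreover have "finite ?P" by simp
    ultimately show "(\<Sum>a\<in>?P. if (w (fst a), w (snd a)) = ql then \<xi> (fst a) (snd a) * f (fst ql) (snd ql) else 0)
        = f (fst ql) (snd ql) * (\<Sum>(i, j)\<in>pairs (?B (fst ql)) (?B (snd ql)). \<xi> i j)"
      by (simp add: sum_distrib_left case_prod_beta mult.commute flip: sum.inter_filter)
  qed
  also have "\<bar>\<dots>\<bar> \<le> (\<Sum>ql\<in>(UNIV :: ('q \<times> 'q) set). L * s)"
  proof (rule order_trans[OF sum_abs], rule sum_mono)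
    fix ql :: "'q \<times> 'q"
    show "\<bar>f (fst ql) (snd ql) * (\<Sum>(i, j)\<in>pairs (?B (fst ql)) (?B (snd ql)). \<xi> i j)\<bar> \<le> L * s"
      unfolding abs_mult by (intro mult_mono f \<xi>) (use \<open>L \<ge> 0\<close> in auto)
  qed
  also have "\<dots> = (real CARD('q))\<^sup>2 * (L * s)"
    by (simp add: power2_eq_square)
  finally show ?thesis .
qed

text \<open>
  The level \<open>n powr (3/2)\<close> is the smallest order for which a union bound over the \<open>4 ^ n\<close> pairs of
  vertex sets succeeds: a sum has at most \<open>n\<^sup>2\<close> terms, so Hoeffding's inequality bounds its tail by
  \<open>2 * exp (- 2 * n)\<close>.
\<close>
definition noise_bounded :: "nat \<Rightarrow> nat \<Rightarrow> (nat \<Rightarrow> real^'q^'q) \<Rightarrow> 'q::finite labels \<Rightarrow> graphs \<Rightarrow> bool" where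
  "noise_bounded n T \<pi> z x \<longleftrightarrow> (\<forall>t\<in>{1..T}. \<forall>B\<subseteq>{1..n}. \<forall>C\<subseteq>{1..n}.
     \<bar>\<Sum>(i, j)\<in>pairs B C. of_bool (x t i j) - \<pi> t $ z i t $ z j t\<bar> \<le> real n powr (3/2))"

definition classes_large :: "nat \<Rightarrow> nat \<Rightarrow> real \<Rightarrow> 'q labels \<Rightarrow> bool" where
  "classes_large n T c z \<longleftrightarrow> (\<forall>t\<in>{1..T}. \<forall>q. c * real n \<le> card {i \<in> {1..n}. z i t = q})"

text \<open>
  The difference of the two log-likelihoods is a sum of Bernoulli divergences plus centred noise weighted by
  logits. Both noise terms have block-constant weights bounded by \<open>- ln \<zeta>\<close>, and the divergences dominate the
  squared errors.
\<close>
lemma squared_error_le: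
  fixes \<pi> \<pi>' :: "nat \<Rightarrow> real^'q^'q::finite"
  assumes \<zeta>: "0 < \<zeta>"
    and \<pi>: "\<And>t q l. t \<in> {1..T} \<Longrightarrow> \<pi> t $ q $ l \<in> {\<zeta>..1 - \<zeta>}"
    and \<pi>': "\<And>t q l. t \<in> {1..T} \<Longrightarrow> \<pi>' t $ q $ l \<in> {\<zeta>..1 - \<zeta>}"
    and noise: "noise_bounded n T \<pi> z x"
    and gap: "edge_loglik n T \<pi> z x - edge_loglik n T \<pi>' z' x \<le> K"
    and t: "t \<in> {1..T}"
  shows "(\<Sum>(i, j)\<in>pairs {1..n} {1..n}. (\<pi> t $ z i t $ z j t - \<pi>' t $ z' i t $ z' j t)\<^sup>2)
    \<le> 4 * (K + 2 * real T * ((real CARD('q))\<^sup>2 * (- ln \<zeta> * real n powr (3/2))))"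
proof -
  let ?P = "pairs {1..n} {1..n}" and ?s = "real n powr (3/2)"
  let ?Q = "(real CARD('q))\<^sup>2 * (- ln \<zeta> * ?s)"
  let ?g = "\<lambda>p :: real. ln p - ln (1 - p)"
  let ?p = "\<lambda>t i j. \<pi> t $ z i t $ z j t" and ?q = "\<lambda>t i j. \<pi>' t $ z' i t $ z' j t"
  let ?\<xi> = "\<lambda>t i j. of_bool (x t i j) - ?p t i j"
  \<comment> \<open>separates the log-likelihood of an edge into a part linear in the observation and a part free of it\<close>
  have lnb: "ln (pmf (bernoulli_pmf p) b) = of_bool b * ?g p + ln (1 - p)" if "p \<in> {\<zeta>..1 - \<zeta>}" for p b
    using that \<zeta> by (cases b) auto
  have step: "(\<Sum>(i, j)\<in>?P. (?p t i j - ?q t i j)\<^sup>2 / 4) - 2 * ?Q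
      \<le> (\<Sum>(i, j)\<in>?P. ln (pmf (bernoulli_pmf (?p t i j)) (x t i j)))
        - (\<Sum>(i, j)\<in>?P. ln (pmf (bernoulli_pmf (?q t i j)) (x t i j)))" if t: "t \<in> {1..T}" for t
  proof -
    have \<xi>: "\<bar>\<Sum>(i, j)\<in>pairs B C. ?\<xi> t i j\<bar> \<le> ?s" if "B \<subseteq> {1..n}" "C \<subseteq> {1..n}" for B C
      using noise t that unfolding noise_bounded_def by blast
    have a: "\<bar>\<Sum>(i, j)\<in>?P. ?\<xi> t i j * ?g (?p t i j)\<bar> \<le> ?Q"
      using abs_logit_le[OF \<pi>[OF t] \<zeta>]
      by (intro block_weighted_sum_le[where f = "\<lambda>q l. ?g (\<pi> t $ q $ l)" and w = "\<lambda>i. z i t", OF \<xi>])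
    have b: "\<bar>\<Sum>(i, j)\<in>?P. ?\<xi> t i j * ?g (?q t i j)\<bar> \<le> ?Q"
      using abs_logit_le[OF \<pi>'[OF t] \<zeta>]
      by (intro block_weighted_sum_le[where f = "\<lambda>q l. ?g (\<pi>' t $ q $ l)" and w = "\<lambda>i. z' i t", OF \<xi>])
    have "(\<Sum>(i, j)\<in>?P. (?p t i j - ?q t i j)\<^sup>2 / 4)
        \<le> (\<Sum>(i, j)\<in>?P. ln (pmf (bernoulli_pmf (?p t i j)) (x t i j)) - ln (pmf (bernoulli_pmf (?q t i j)) (x t i j))
              - ?\<xi> t i j * ?g (?p t i j) + ?\<xi> t i j * ?g (?q t i j))"
    proof (rule sum_mono, clarify)
      fix i j
      let ?a = "?p t i j" and ?b = "?q t i j"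
      have "(?a - ?b)\<^sup>2 / 4 \<le> ?a * (ln ?a - ln ?b) + (1 - ?a) * (ln (1 - ?a) - ln (1 - ?b))"
        using \<pi>[OF t, of "z i t" "z j t"] \<pi>'[OF t, of "z' i t" "z' j t"] \<zeta>
        by (intro bernoulli_kl_ge) auto
      then show "(?a - ?b)\<^sup>2 / 4 \<le> ln (pmf (bernoulli_pmf ?a) (x t i j)) - ln (pmf (bernoulli_pmf ?b) (x t i j))
              - ?\<xi> t i j * ?g ?a + ?\<xi> t i j * ?g ?b"
        unfolding lnb[OF \<pi>[OF t]] lnb[OF \<pi>'[OF t]] by (simp add: algebra_simps)
    qed
    also have "\<dots> = (\<Sum>(i, j)\<in>?P. ln (pmf (bernoulli_pmf (?p t i j)) (x t i j)))
        - (\<Sum>(i, j)\<in>?P. ln (pmf (bernoulli_pmf (?q t i j)) (x t i j)))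
        - (\<Sum>(i, j)\<in>?P. ?\<xi> t i j * ?g (?p t i j)) + (\<Sum>(i, j)\<in>?P. ?\<xi> t i j * ?g (?q t i j))"
      by (simp add: case_prod_beta sum.distrib sum_subtractf)
    finally show ?thesis using a b by linarith
  qed
  have *: "(\<Sum>t\<in>{1..T}. (\<Sum>(i, j)\<in>?P. (?p t i j - ?q t i j)\<^sup>2 / 4) - 2 * ?Q)
      \<le> edge_loglik n T \<pi> z x - edge_loglik n T \<pi>' z' x"
  proof -
    have "edge_loglik n T \<rho> w x = (\<Sum>t\<in>{1..T}. \<Sum>(i, j)\<in>?P. ln (pmf (bernoulli_pmf (\<rho> t $ w i t $ w j t)) (x t i j)))"
      for \<rho> :: "nat \<Rightarrow> real^'q^'q" and w
      unfolding edge_loglik_def edges_eq_Times by (subst sum.cartesian_product) (rule refl)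
    note el = this
    show ?thesis
      unfolding el sum_subtractf[symmetric, where g = "\<lambda>t. \<Sum>(i, j)\<in>?P. ln (pmf (bernoulli_pmf (?q t i j)) (x t i j))"]
      by (rule sum_mono) (rule step)
  qed
  have "(\<Sum>t\<in>{1..T}. \<Sum>(i, j)\<in>?P. (?p t i j - ?q t i j)\<^sup>2 / 4) \<le> K + real T * (2 * ?Q)"
  proof -
    have "(\<Sum>t\<in>{1..T}. S t - d) = (\<Sum>t\<in>{1..T}. S t) - real T * d" for S :: "nat \<Rightarrow> real" and d
      by (simp add: sum_subtractf)
    from *[unfolded this] gap show ?thesis by linarith
  qed
  moreover have "(\<Sum>(i, j)\<in>?P. (?p t i j - ?q t i j)\<^sup>2 / 4)
      \<le> (\<Sum>t\<in>{1..T}. \<Sum>(i, j)\<in>?P. (?p t i j - ?q t i j)\<^sup>2 / 4)"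
    using t by (intro member_le_sum) (auto intro!: sum_nonneg)
  moreover have "(\<Sum>(i, j)\<in>?P. (?p t i j - ?q t i j)\<^sup>2 / 4) = (\<Sum>(i, j)\<in>?P. (?p t i j - ?q t i j)\<^sup>2) / 4"
    by (simp add: case_prod_beta sum_divide_distrib)
  ultimately show ?thesis by simp
qed

text \<open>
  Any two distinct elements of \<open>A\<close> and \<open>B\<close> form a pair in one of the two orders.
\<close>
lemma card_pairs_ge:
  assumes "finite A" "finite B"
  shows "card A * (card B - 1) \<le> card (pairs A B) + card (pairs B A)"
proof -
  let ?swap = "\<lambda>(i :: nat, j :: nat). (j, i)"
  have "card A * (card B - 1) = (\<Sum>i\<in>A. card B - 1)" by simp
  also have "\<dots> \<le> (\<Sum>i\<in>A. card (B - {i}))" by (intro sum_mono) (auto simp: card_Diff_singleton_if)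
  also have "\<dots> = card (SIGMA i:A. B - {i})" using assms by (simp add: card_SigmaI)
  also have "\<dots> \<le> card (pairs A B \<union> ?swap ` pairs B A)"
  proof (rule card_mono)
    show "finite (pairs A B \<union> ?swap ` pairs B A)" using assms by simp
    show "(SIGMA i:A. B - {i}) \<subseteq> pairs A B \<union> ?swap ` pairs B A"
    proof
      fix a assume "a \<in> (SIGMA i:A. B - {i})"
      then obtain i j where a: "a = (i, j)" "i \<in> A" "j \<in> B" "j \<noteq> i" by auto
      show "a \<in> pairs A B \<union> ?swap ` pairs B A"
      proof (cases "i < j")
        case True
        then show ?thesis using a by (simp add: pairs_def)
      next
        case False
        then have "(j, i) \<in> pairs B A" using a by (simp add: pairs_def)
        then have "a \<in> ?swap ` pairs B A" by (rule rev_image_eqI) (simp add: a(1))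
        then show ?thesis ..
      qed
    qed
  qed
  also have "\<dots> \<le> card (pairs A B) + card (?swap ` pairs B A)" by (rule card_Un_le)
  also have "\<dots> \<le> card (pairs A B) + card (pairs B A)" using assms by (intro add_left_mono card_image_le) auto
  finally show ?thesis .
qed

lemma majority_class:
  fixes f :: "nat \<Rightarrow> 'q::finite"
  assumes "finite A" "c \<le> real (card A)"
  shows "\<exists>k. c / real CARD('q) \<le> real (card {i \<in> A. f i = k})"
proof (rule ccontr)
  assume "\<not> ?thesis"
  then have "real (card {i \<in> A. f i = k}) < c / real CARD('q)" for k by (simp add: not_le)
  then have "(\<Sum>k\<in>UNIV. real (card {i \<in> A. f i = k})) < (\<Sum>k\<in>(UNIV :: 'q set). c / real CARD('q))"
    by (intro sum_strict_mono) auto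
  also have "\<dots> = c" by simp
  also have "(\<Sum>k\<in>UNIV. real (card {i \<in> A. f i = k})) = real (card (\<Union>k. {i \<in> A. f i = k}))"
    using assms(1) by (subst card_UN_disjoint) auto
  also have "(\<Union>k. {i \<in> A. f i = k}) = A" by auto
  finally show False using assms by simp
qed

text \<open>
  Let \<open>\<sigma> q\<close> be an estimated class that is most frequent among the nodes of true class \<open>q\<close>. At least a
  fraction \<open>1/Q\<close> of these nodes carries it, so of the order of \<open>n\<^sup>2\<close> pairs contribute the same squared error
  for the true classes \<open>q\<close> and \<open>l\<close>. This cannot exceed the total squared error \<open>V\<close>. The labelling
  \<open>z'\<close> may otherwise be arbitrarily bad.
\<close>
lemma block_error_le:
  fixes \<pi> \<pi>' :: "real^'q^'q::finite" and z z' :: "nat \<Rightarrow> 'q"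
  assumes sym: "transpose \<pi> = \<pi>" "transpose \<pi>' = \<pi>'"
    and err: "(\<Sum>(i, j)\<in>pairs {1..n} {1..n}. (\<pi> $ z i $ z j - \<pi>' $ z' i $ z' j)\<^sup>2) \<le> V"
    and large: "\<And>q. c * real n \<le> card {i \<in> {1..n}. z i = q}"
    and c: "0 < c" and n: "2 * real CARD('q) \<le> c * real n"
  shows "\<exists>\<sigma>. \<forall>q l. (\<pi> $ q $ l - \<pi>' $ \<sigma> q $ \<sigma> l)\<^sup>2 \<le> 4 * (real CARD('q))\<^sup>2 * V / (c * real n)\<^sup>2"
proof -
  define m where "m = c * real n / real CARD('q)"
  have m: "2 \<le> m" using n by (simp add: m_def field_simps)
  have "\<exists>k. m \<le> card {i \<in> {i \<in> {1..n}. z i = q}. z' i = k}" for q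
    unfolding m_def by (rule majority_class) (use large in auto)
  then obtain \<sigma> where \<sigma>: "\<And>q. m \<le> card {i \<in> {i \<in> {1..n}. z i = q}. z' i = \<sigma> q}" by metis
  define A where "A q = {i \<in> {i \<in> {1..n}. z i = q}. z' i = \<sigma> q}" for q
  have fin: "finite (A q)" for q by (simp add: A_def)
  \<comment> \<open>on these pairs true and estimated connectivities are constant, so each contributes the same amount\<close>
  have pair: "real (card (pairs (A q) (A l))) * (\<pi> $ q $ l - \<pi>' $ \<sigma> q $ \<sigma> l)\<^sup>2 \<le> V" for q l
  proof -
    have "real (card (pairs (A q) (A l))) * (\<pi> $ q $ l - \<pi>' $ \<sigma> q $ \<sigma> l)\<^sup>2
        = (\<Sum>(i, j)\<in>pairs (A q) (A l). (\<pi> $ z i $ z j - \<pi>' $ z' i $ z' j)\<^sup>2)"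
    proof -
      have "(\<Sum>(i, j)\<in>pairs (A q) (A l). (\<pi> $ z i $ z j - \<pi>' $ z' i $ z' j)\<^sup>2)
          = (\<Sum>(i, j)\<in>pairs (A q) (A l). (\<pi> $ q $ l - \<pi>' $ \<sigma> q $ \<sigma> l)\<^sup>2)"
        by (rule sum.cong) (auto simp: A_def pairs_def)
      then show ?thesis by simp
    qed
    also have "\<dots> \<le> (\<Sum>(i, j)\<in>pairs {1..n} {1..n}. (\<pi> $ z i $ z j - \<pi>' $ z' i $ z' j)\<^sup>2)"
      by (rule sum_mono2[OF finite_pairs]) (auto simp: A_def pairs_def)
    finally show ?thesis using err by linarith
  qed
  have "(\<pi> $ q $ l - \<pi>' $ \<sigma> q $ \<sigma> l)\<^sup>2 \<le> 4 * (real CARD('q))\<^sup>2 * V / (c * real n)\<^sup>2" for q l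
  proof -
    let ?D = "(\<pi> $ q $ l - \<pi>' $ \<sigma> q $ \<sigma> l)\<^sup>2"
    \<comment> \<open>symmetry lets the pairs listed in the other order count towards the same entry\<close>
    have "\<pi> $ l $ q = \<pi> $ q $ l" "\<pi>' $ \<sigma> l $ \<sigma> q = \<pi>' $ \<sigma> q $ \<sigma> l"
      using sym by (auto simp: transpose_def vec_eq_iff)
    then have lq: "real (card (pairs (A l) (A q))) * ?D \<le> V" using pair[of l q] by simp
    have mq: "m \<le> card (A q)" "m \<le> card (A l)" using \<sigma> by (auto simp: A_def)
    then have "m / 2 \<le> real (card (A l) - 1)" using m by linarith
    then have "m * (m / 2) \<le> real (card (A q)) * real (card (A l) - 1)"
      using mq m by (intro mult_mono) auto
    also have "\<dots> \<le> real (card (pairs (A q) (A l))) + real (card (pairs (A l) (A q)))"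
      using card_pairs_ge[OF fin[of q] fin[of l]] by (simp flip: of_nat_mult of_nat_add)
    finally have "m * (m / 2) * ?D \<le> (real (card (pairs (A q) (A l))) + real (card (pairs (A l) (A q)))) * ?D"
      by (intro mult_right_mono) auto
    also have "\<dots> \<le> 2 * V" using pair[of q l] lq by (simp add: distrib_right)
    finally have "m\<^sup>2 * ?D \<le> 4 * V" by (simp add: power2_eq_square)
    then have "?D \<le> 4 * V / m\<^sup>2" using m by (simp add: field_simps)
    also have "\<dots> = 4 * (real CARD('q))\<^sup>2 * V / (c * real n)\<^sup>2"
      by (simp add: m_def power_divide)
    finally show ?thesis .
  qed
  then show ?thesis by blast
qed

text \<open>
  The diagonal values identify the classes. If two classes, possibly at different times, were sent to the same
  estimated class, then their diagonal values would be within \<open>2 * \<eta>\<close> of each other. So the maps are injective, and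
  they agree at all times since both diagonals are constant in time.
\<close>
lemma align_classes:
  fixes \<pi> \<pi>' :: "nat \<Rightarrow> real^'q^'q::finite"
  assumes T: "T \<ge> 1"
    and diag: "\<And>s t q. s \<in> {1..T} \<Longrightarrow> t \<in> {1..T} \<Longrightarrow> \<pi> s $ q $ q = \<pi> t $ q $ q"
    and diag': "\<And>s t q. s \<in> {1..T} \<Longrightarrow> t \<in> {1..T} \<Longrightarrow> \<pi>' s $ q $ q = \<pi>' t $ q $ q"
    and gap: "\<And>q q'. q \<noteq> q' \<Longrightarrow> 2 * \<eta> < \<bar>\<pi> 1 $ q $ q - \<pi> 1 $ q' $ q'\<bar>"
    and close: "\<And>t. t \<in> {1..T} \<Longrightarrow> \<exists>\<sigma>. \<forall>q l. \<bar>\<pi> t $ q $ l - \<pi>' t $ \<sigma> q $ \<sigma> l\<bar> \<le> \<eta>"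
  shows "\<exists>\<sigma>. \<sigma> permutes UNIV \<and> (\<forall>t\<in>{1..T}. \<forall>q l. \<bar>\<pi> t $ q $ l - \<pi>' t $ \<sigma> q $ \<sigma> l\<bar> \<le> \<eta>)"
proof -
  obtain \<sigma> where \<sigma>: "\<And>t q l. t \<in> {1..T} \<Longrightarrow> \<bar>\<pi> t $ q $ l - \<pi>' t $ \<sigma> t q $ \<sigma> t l\<bar> \<le> \<eta>"
    using close by metis
  have one: "1 \<in> {1..T}" using T by simp
  have inj: "q = q'" if "s \<in> {1..T}" "t \<in> {1..T}" "\<sigma> s q = \<sigma> t q'" for s t q q'
  proof (rule ccontr)
    assume "q \<noteq> q'"
    then have "2 * \<eta> < \<bar>\<pi> 1 $ q $ q - \<pi> 1 $ q' $ q'\<bar>" by (rule gap)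
    moreover have "\<bar>\<pi> 1 $ q $ q - \<pi>' 1 $ \<sigma> s q $ \<sigma> s q\<bar> \<le> \<eta>"
      using \<sigma>[OF that(1), of q q] by (simp add: diag[OF that(1) one] diag'[OF that(1) one])
    moreover have "\<bar>\<pi> 1 $ q' $ q' - \<pi>' 1 $ \<sigma> s q $ \<sigma> s q\<bar> \<le> \<eta>"
      using \<sigma>[OF that(2), of q' q'] by (simp add: that(3) diag[OF that(2) one] diag'[OF that(2) one])
    ultimately show False by linarith
  qed
  have bij: "bij (\<sigma> t)" if "t \<in> {1..T}" for t
  proof -
    have "inj (\<sigma> t)" using inj[OF that that] by (rule injI)
    then show ?thesis by (simp add: bij_def finite_UNIV_inj_surj)
  qed
  have same: "\<sigma> t q = \<sigma> 1 q" if t: "t \<in> {1..T}" for t q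
  proof -
    obtain q' where "\<sigma> t q = \<sigma> 1 q'" using bij[OF one] by (metis bij_pointE)
    with inj[OF t one this] show ?thesis by simp
  qed
  have "\<bar>\<pi> t $ q $ l - \<pi>' t $ \<sigma> 1 q $ \<sigma> 1 l\<bar> \<le> \<eta>" if "t \<in> {1..T}" for t q l
    using \<sigma>[OF that, of q l] unfolding same[OF that, of q] same[OF that, of l] .
  moreover have "\<sigma> 1 permutes UNIV" by (rule bij_imp_permutes[OF bij[OF one]]) simp
  ultimately show ?thesis by blast
qed

lemma dist_up_to_perm_le:
  fixes \<pi> \<pi>' :: "nat \<Rightarrow> real^'q^'q::finite"
  assumes "T \<ge> 1" "\<sigma> permutes UNIV"
    and "\<And>t q l. t \<in> {1..T} \<Longrightarrow> \<bar>\<pi> t $ q $ l - \<pi>' t $ \<sigma> q $ \<sigma> l\<bar> \<le> \<eta>"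
  shows "dist_up_to_perm T \<pi>' \<pi> \<le> \<eta>"
proof -
  have "dist_max T (permute_classes \<sigma> \<pi>') \<pi> \<le> \<eta>"
    unfolding dist_max_def using assms by (subst Max_le_iff) (auto simp: permute_classes_def abs_minus_commute)
  moreover have "dist_up_to_perm T \<pi>' \<pi> \<le> dist_max T (permute_classes \<sigma> \<pi>') \<pi>"
    unfolding dist_up_to_perm_def using assms(2) by (intro Min_le) (auto simp: finite_permutations)
  ultimately show ?thesis by linarith
qed

text \<open>
  Twice \<open>Q / c\<close> comes from the size of the majority blocks. Under the root stands the
  constant in the bound on the total squared error: its first part is the price of the prior, its second part the
  noise.
\<close>
definition rate_const :: "real \<Rightarrow> nat \<Rightarrow> real \<Rightarrow> real \<Rightarrow> real \<Rightarrow> real" where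
  "rate_const Q T \<delta> \<zeta> c = 2 * Q / c * sqrt (4 * (real T * (- ln \<delta>) + 2 * real T * (Q\<^sup>2 * (- ln \<zeta>))))"

text \<open>
  The deterministic core of the theorem. The log-likelihood gap is at most of the order of the noise, so the
  total squared error over the pairs at each time is of order \<open>n powr (3/2)\<close>. Dividing by the order
  \<open>n\<^sup>2\<close> of the number of pairs in a block leaves \<open>n powr (- 1/2)\<close>, and its square root is the rate.
  The bound holds for every parameter that is at least as good as the true one, so it can be used before a
  maximizer is known to exist.
\<close>
lemma near_maximizer_close:
  fixes \<theta> \<theta>s :: "'q::finite param" and chihat :: "'q param \<Rightarrow> 'q vparam"
  defines "Q \<equiv> real CARD('q)"
  assumes pos: "0 < \<delta>" "0 < \<zeta>" "\<delta> \<le> 1" "\<zeta> \<le> 1" and T: "T \<ge> 1"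
    and x: "x \<in> graph_space n T" and z: "z \<in> labelings n T"
    and chihat: "\<And>\<theta>. \<theta> \<in> param_space T \<delta> \<zeta> \<Longrightarrow> is_chi_hat n T x \<theta> (chihat \<theta>)"
    and \<theta>s: "\<theta>s \<in> param_space T \<delta> \<zeta>" and \<theta>: "\<theta> \<in> param_space T \<delta> \<zeta>"
    and noise: "noise_bounded n T (snd \<theta>s) z x" and large: "classes_large n T c z"
    and ge: "profile n T x chihat \<theta>s \<le> profile n T x chihat \<theta>"
    and c: "0 < c" and n: "2 * Q \<le> c * real n"
    and gap: "\<And>q q'. q \<noteq> q' \<Longrightarrow>
      2 * (rate_const Q T \<delta> \<zeta> c * real n powr (- 1/4)) < \<bar>snd \<theta>s 1 $ q $ q - snd \<theta>s 1 $ q' $ q'\<bar>"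
  shows "\<exists>\<sigma>. \<sigma> permutes UNIV \<and> (\<forall>t\<in>{1..T}. \<forall>q l.
    \<bar>snd \<theta>s t $ q $ l - snd \<theta> t $ \<sigma> q $ \<sigma> l\<bar> \<le> rate_const Q T \<delta> \<zeta> c * real n powr (- 1/4))"
proof -
  let ?C = "rate_const Q T \<delta> \<zeta> c" and ?s = "real n powr (3/2)"
  let ?V0 = "4 * (real T * (- ln \<delta>) + 2 * real T * (Q\<^sup>2 * (- ln \<zeta>)))"
  have Q: "0 < Q" by (simp add: Q_def)
  have n0: "0 < n" using n Q c by (cases n) auto
  have lnd: "0 \<le> - ln \<delta>" "0 \<le> - ln \<zeta>" using pos by auto
  have V0: "0 \<le> ?V0"
    using lnd by (intro mult_nonneg_nonneg add_nonneg_nonneg) auto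
  have C0: "0 \<le> ?C" unfolding rate_const_def using V0 Q c by (intro mult_nonneg_nonneg) auto
  obtain z' :: "'q labels" where z': "profile n T x chihat \<theta> \<le> edge_loglik n T (snd \<theta>) z' x"
    using profile_le[OF pos(1,2) x chihat \<theta>] by blast
  have "edge_loglik n T (snd \<theta>s) z x - edge_loglik n T (snd \<theta>) z' x \<le> real (T * n) * (- ln \<delta>)"
    using profile_ge[OF pos(1,2) x chihat \<theta>s z] ge z' by simp
  also have "\<dots> \<le> real T * (- ln \<delta>) * ?s"
  proof -
    \<comment> \<open>the prior cost is linear in the number of nodes and is absorbed into the noise level\<close>
    have "real n powr 1 \<le> ?s" using n0 by (intro powr_mono) auto
    then have "real T * (- ln \<delta>) * real n \<le> real T * (- ln \<delta>) * ?s"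
      using lnd by (intro mult_left_mono mult_nonneg_nonneg) auto
    then show ?thesis by (simp add: mult_ac)
  qed
  finally have K: "edge_loglik n T (snd \<theta>s) z x - edge_loglik n T (snd \<theta>) z' x \<le> real T * (- ln \<delta>) * ?s" .
  have close: "\<exists>\<sigma>. \<forall>q l. \<bar>snd \<theta>s t $ q $ l - snd \<theta> t $ \<sigma> q $ \<sigma> l\<bar> \<le> ?C * real n powr (- 1/4)"
    if t: "t \<in> {1..T}" for t
  proof -
    have V: "(\<Sum>(i, j)\<in>pairs {1..n} {1..n}. (snd \<theta>s t $ z i t $ z j t - snd \<theta> t $ z' i t $ z' j t)\<^sup>2) \<le> ?V0 * ?s"
      using squared_error_le[OF pos(2) param_spaceD(2)[OF \<theta>s] param_spaceD(2)[OF \<theta>] noise K t]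
      by (simp add: Q_def algebra_simps)
    have "\<exists>\<sigma>. \<forall>q l. (snd \<theta>s t $ q $ l - snd \<theta> t $ \<sigma> q $ \<sigma> l)\<^sup>2 \<le> 4 * Q\<^sup>2 * (?V0 * ?s) / (c * real n)\<^sup>2"
      unfolding Q_def
    proof (rule block_error_le[where z = "\<lambda>i. z i t" and z' = "\<lambda>i. z' i t", OF _ _ V[unfolded Q_def]])
      show "transpose (snd \<theta>s t) = snd \<theta>s t" "transpose (snd \<theta> t) = snd \<theta> t"
        by (rule param_spaceD(1)[OF \<theta>s t], rule param_spaceD(1)[OF \<theta> t])
      show "c * real n \<le> card {i \<in> {1..n}. z i t = q}" for q
        using large t unfolding classes_large_def by blast
      show "0 < c" by (rule c)
      show "2 * real CARD('q) \<le> c * real n" using n unfolding Q_def .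
    qed
    moreover have "4 * Q\<^sup>2 * (?V0 * ?s) / (c * real n)\<^sup>2 = (?C * real n powr (- 1/4))\<^sup>2"
    proof -
      have "(real n powr (- 1/4))\<^sup>2 = real n powr (- 1/2)"
        by (simp add: power2_eq_square flip: powr_add)
      moreover have "?s / (real n)\<^sup>2 = real n powr (- 1/2)"
        using n0 by (simp add: flip: powr_numeral powr_diff)
      moreover have "?C\<^sup>2 = 4 * Q\<^sup>2 * ?V0 / c\<^sup>2"
        using V0 by (simp add: rate_const_def power_mult_distrib power_divide)
      moreover have "4 * Q\<^sup>2 * (?V0 * ?s) / (c * real n)\<^sup>2 = 4 * Q\<^sup>2 * ?V0 / c\<^sup>2 * (?s / (real n)\<^sup>2)"
        unfolding power_mult_distrib times_divide_times_eq by (simp only: mult.assoc)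
      ultimately show ?thesis by (simp only: power_mult_distrib)
    qed
    ultimately have "\<exists>\<sigma>. \<forall>q l. (snd \<theta>s t $ q $ l - snd \<theta> t $ \<sigma> q $ \<sigma> l)\<^sup>2 \<le> (?C * real n powr (- 1/4))\<^sup>2"
      by (simp only:)
    then obtain \<sigma> where \<sigma>: "\<And>q l. (snd \<theta>s t $ q $ l - snd \<theta> t $ \<sigma> q $ \<sigma> l)\<^sup>2 \<le> (?C * real n powr (- 1/4))\<^sup>2"
      by blast
    have "\<bar>snd \<theta>s t $ q $ l - snd \<theta> t $ \<sigma> q $ \<sigma> l\<bar> \<le> ?C * real n powr (- 1/4)" for q l
    proof -
      have W: "0 \<le> ?C * real n powr (- 1/4)" using C0 by simp
      from iffD2[OF abs_le_square_iff \<sigma>[of q l]] show ?thesis unfolding abs_of_nonneg[OF W] .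
    qed
    then show ?thesis by blast
  qed
  show ?thesis
    by (rule align_classes[where \<pi> = "snd \<theta>s" and \<pi>' = "snd \<theta>", OF T param_spaceD(3)[OF \<theta>s] param_spaceD(3)[OF \<theta>] gap close])
qed

section \<open>Concentration\<close>

text \<open>
  Hoeffding's inequality for independent events, one per coordinate.
\<close>
lemma Pi_pmf_Hoeffding:
  fixes X :: "'a \<Rightarrow> 'b \<Rightarrow> bool"
  assumes I: "finite I" and A: "A \<subseteq> I" "A \<noteq> {}" and s: "0 \<le> s"
  shows "measure_pmf.prob (Pi_pmf I d p)
      {e. s \<le> \<bar>(\<Sum>a\<in>A. of_bool (X a (e a))) - (\<Sum>a\<in>A. measure_pmf.prob (p a) {b. X a b})\<bar>}
    \<le> 2 * exp (- 2 * s\<^sup>2 / real (card A))"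
proof -
  let ?M = "Pi_pmf I d p" and ?X = "\<lambda>a e. of_bool (X a (e a)) :: real"
  have fin: "finite A" using A I finite_subset by blast
  have "prob_space.indep_vars ?M (\<lambda>_. count_space UNIV) (\<lambda>x f. f x) A"
    using indep_vars_Pi_pmf[OF I] A(1)
    by (rule prob_space.indep_vars_subset[OF measure_pmf.prob_space_axioms])
  then have indep: "prob_space.indep_vars ?M (\<lambda>_. borel) ?X A"
    by (rule prob_space.indep_vars_compose2[OF measure_pmf.prob_space_axioms, where Y = "\<lambda>a b. of_bool (X a b)"]) simp
  interpret Hoeffding_ineq ?M A ?X "\<lambda>_. 0" "\<lambda>_. 1" "\<Sum>a\<in>A. measure_pmf.expectation ?M (?X a)"
  proof unfold_locales
    show "finite A" by (rule fin)
    show "prob_space.indep_vars ?M (\<lambda>_. borel) ?X A" by (rule indep)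
  qed simp_all
  have "measure_pmf.expectation ?M (?X a) = measure_pmf.prob (p a) {b. X a b}" if "a \<in> A" for a
  proof -
    have "?X a = indicator {e. X a (e a)}" by (auto simp: indicator_def fun_eq_iff)
    then have "measure_pmf.expectation ?M (?X a) = measure_pmf.prob (map_pmf (\<lambda>e. e a) ?M) {b. X a b}"
      by (simp add: vimage_def)
    also have "map_pmf (\<lambda>e. e a) ?M = p a" using that A I by (subst Pi_pmf_component) auto
    finally show ?thesis by simp
  qed
  then have "(\<Sum>a\<in>A. measure_pmf.expectation ?M (?X a)) = (\<Sum>a\<in>A. measure_pmf.prob (p a) {b. X a b})"
    by (rule sum.cong[OF refl])
  moreover have "0 < card A" using fin A by (simp add: card_gt_0_iff)
  ultimately show ?thesis using Hoeffding_ineq_abs_ge[OF s] by simp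
qed

lemma prob_union_le:
  assumes "finite I" "E \<subseteq> (\<Union>i\<in>I. F i)" "\<And>i. i \<in> I \<Longrightarrow> measure_pmf.prob p (F i) \<le> b"
  shows "measure_pmf.prob p E \<le> real (card I) * b"
proof -
  have "measure_pmf.prob p E \<le> measure_pmf.prob p (\<Union>i\<in>I. F i)"
    using assms(2) by (intro measure_pmf.finite_measure_mono) auto
  also have "\<dots> \<le> (\<Sum>i\<in>I. measure_pmf.prob p (F i))"
    using assms(1) by (intro measure_UNION_le) auto
  also have "\<dots> \<le> (\<Sum>i\<in>I. b)" using assms(3) by (rule sum_mono)
  finally show ?thesis by simp
qed

text \<open>
  With at most \<open>n\<^sup>2\<close> pairs, the exponent \<open>2 * (n powr (3/2))\<^sup>2 / card (pairs B C)\<close> is at least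
  \<open>2 * n\<close>.
\<close>
lemma block_noise_tail:
  fixes \<pi> :: "nat \<Rightarrow> real^'q^'q::finite"
  assumes n: "n \<ge> 1" and t: "t \<in> {1..T}" and BC: "B \<subseteq> {1..n}" "C \<subseteq> {1..n}"
    and \<pi>: "\<And>q l. \<pi> t $ q $ l \<in> {0..1}"
  shows "measure_pmf.prob (graph_law n T \<pi> z)
      {x. real n powr (3/2) < \<bar>\<Sum>(i, j)\<in>pairs B C. of_bool (x t i j) - \<pi> t $ z i t $ z j t\<bar>}
    \<le> 2 * exp (- 2 * real n)" (is "measure_pmf.prob _ ?E \<le> _")
proof (cases "pairs B C = {}")
  case True
  then show ?thesis by simp
next
  case False
  let ?s = "real n powr (3/2)"
  let ?p = "\<lambda>(t, i, j). bernoulli_pmf (\<pi> t $ z i t $ z j t)"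
  let ?P = "Pi_pmf (edges n T) False ?p"
  let ?A = "Pair t ` pairs B C"
  have fin: "finite (pairs B C)" using BC finite_subset by (metis finite_pairs finite_atLeastAtMost)
  have "card (pairs B C) \<le> card ({1..n} \<times> {1..n})"
    using BC by (intro card_mono) (auto simp: pairs_def)
  then have "card ?A \<le> n * n" by (simp add: card_image inj_on_def)
  have sub: "?A \<subseteq> edges n T" using BC t by (auto simp: edges_def pairs_def)
  have "measure_pmf.prob (graph_law n T \<pi> z) ?E = measure_pmf.prob ?P ((\<lambda>e t i j. e (t, min i j, max i j)) -` ?E)"
    unfolding graph_law_def edges_def[symmetric] by simp
  also have "\<dots> \<le> measure_pmf.prob ?P {e. ?s \<le> \<bar>(\<Sum>a\<in>?A. of_bool (e a)) - (\<Sum>a\<in>?A. measure_pmf.prob (?p a) {b. b})\<bar>}"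
  proof (rule measure_pmf.finite_measure_mono)
    have p: "measure_pmf.prob (?p a) {b. b} = \<pi> t $ z (fst (snd a)) t $ z (snd (snd a)) t" if "a \<in> ?A" for a
    proof -
      have "{b. b} = {True}" by auto
      then have "measure_pmf.prob (bernoulli_pmf r) {b. b} = r" if "0 \<le> r" "r \<le> 1" for r
        using that by (simp add: measure_pmf_single)
      then show ?thesis using that \<pi> by auto
    qed
    have "(\<Sum>(i, j)\<in>pairs B C. of_bool (e (t, min i j, max i j)) - \<pi> t $ z i t $ z j t)
        = (\<Sum>a\<in>?A. of_bool (e a)) - (\<Sum>a\<in>?A. measure_pmf.prob (?p a) {b. b})" for e
    proof -
      have "(\<Sum>(i, j)\<in>pairs B C. of_bool (e (t, min i j, max i j)) - \<pi> t $ z i t $ z j t)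
          = (\<Sum>a\<in>pairs B C. of_bool (e (t, a)) - \<pi> t $ z (fst a) t $ z (snd a) t)"
        by (rule sum.cong) (auto simp: pairs_def min_def max_def)
      also have "\<dots> = (\<Sum>a\<in>?A. of_bool (e a) - \<pi> t $ z (fst (snd a)) t $ z (snd (snd a)) t)"
        by (subst sum.reindex) (auto simp: inj_on_def)
      also have "\<dots> = (\<Sum>a\<in>?A. of_bool (e a) - measure_pmf.prob (?p a) {b. b})"
        by (intro sum.cong refl) (simp only: p)
      finally show ?thesis by (simp add: sum_subtractf)
    qed
    then show "(\<lambda>e t i j. e (t, min i j, max i j)) -` ?E
        \<subseteq> {e. ?s \<le> \<bar>(\<Sum>a\<in>?A. of_bool (e a)) - (\<Sum>a\<in>?A. measure_pmf.prob (?p a) {b. b})\<bar>}"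
      by (auto simp: less_imp_le)
  qed simp
  also have "\<dots> \<le> 2 * exp (- 2 * ?s\<^sup>2 / real (card ?A))"
    by (rule Pi_pmf_Hoeffding[where X = "\<lambda>_ b. b"]) (use sub False in auto)
  also have "\<dots> \<le> 2 * exp (- 2 * real n)"
  proof -
    have c0: "0 < real (card ?A)" using fin False by (simp add: card_gt_0_iff)
    have "?s\<^sup>2 = real n * (real n * real n)"
    proof -
      have "?s\<^sup>2 = real n powr 3" by (simp add: power2_eq_square flip: powr_add)
      also have "\<dots> = real n ^ 3" using n by (simp add: powr_numeral)
      finally show ?thesis by (simp add: power3_eq_cube)
    qed
    moreover have "real n * real (card ?A) \<le> real n * (real n * real n)"
      using \<open>card ?A \<le> n * n\<close> by (intro mult_left_mono) (simp_all flip: of_nat_mult)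
    ultimately have "real n \<le> ?s\<^sup>2 / real (card ?A)" using c0 by (simp add: field_simps)
    then show ?thesis by simp
  qed
  finally show ?thesis .
qed

lemma noise_bounded_tail:
  fixes \<pi> :: "nat \<Rightarrow> real^'q^'q::finite"
  assumes n: "n \<ge> 1" and \<pi>: "\<And>t q l. t \<in> {1..T} \<Longrightarrow> \<pi> t $ q $ l \<in> {0..1}"
  shows "measure_pmf.prob (graph_law n T \<pi> z) {x. \<not> noise_bounded n T \<pi> z x}
    \<le> 2 * real T * (4 * exp (- 2)) ^ n"
proof -
  let ?I = "{1..T} \<times> Pow {1..n} \<times> Pow {1..n}"
  let ?F = "\<lambda>(t, B, C). {x. real n powr (3/2) < \<bar>\<Sum>(i, j)\<in>pairs B C. of_bool (x t i j) - \<pi> t $ z i t $ z j t\<bar>}"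
  have "measure_pmf.prob (graph_law n T \<pi> z) {x. \<not> noise_bounded n T \<pi> z x} \<le> real (card ?I) * (2 * exp (- 2 * real n))"
  proof (rule prob_union_le)
    show "{x. \<not> noise_bounded n T \<pi> z x} \<subseteq> (\<Union>i\<in>?I. ?F i)"
      by (fastforce simp: noise_bounded_def not_le)
    show "measure_pmf.prob (graph_law n T \<pi> z) (?F a) \<le> 2 * exp (- 2 * real n)" if "a \<in> ?I" for a
    proof -
      obtain t B C where a: "a = (t, B, C)" by (cases a)
      then have "t \<in> {1..T}" "B \<subseteq> {1..n}" "C \<subseteq> {1..n}" using that by auto
      from block_noise_tail[where \<pi> = \<pi> and z = z and t = t and B = B and C = C, OF n this \<pi>[OF this(1)]] show ?thesis by (simp add: a)
    qed
  qed auto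
  also have "real (card ?I) = real T * 4 ^ n"
    by (simp add: card_cartesian_product card_Pow power_mult_distrib[symmetric])
  also have "real T * 4 ^ n * (2 * exp (- 2 * real n)) = 2 * real T * (4 * exp (- 2)) ^ n"
    by (simp add: power_mult_distrib exp_of_nat_mult[symmetric] mult_ac)
  finally show ?thesis .
qed

text \<open>
  At each time a node has each given label with probability at least \<open>\<delta>\<close>, independently of the other
  nodes, so the class sizes concentrate above \<open>\<delta> * n / 2\<close>.
\<close>
lemma classes_large_tail:
  fixes \<Gamma> :: "real^'q^'q::finite"
  assumes \<Gamma>: "\<Gamma> \<in> pos_stochastic \<delta>" "0 < \<delta>" and n: "n \<ge> 1"
  shows "measure_pmf.prob (latent_law n T \<Gamma>) {z. \<not> classes_large n T (\<delta> / 2) z}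
    \<le> 2 * real T * real CARD('q) * exp (- (\<delta>\<^sup>2 / 2)) ^ n"
proof -
  let ?I = "{1..T} \<times> (UNIV :: 'q set)"
  let ?c = "chain_pmf (stationary \<Gamma>) (\<lambda>_. kernel \<Gamma>) T"
  let ?F = "\<lambda>(t, q). {z. real (card {i \<in> {1..n}. z i t = q}) < \<delta> / 2 * real n}"
  have "measure_pmf.prob (latent_law n T \<Gamma>) {z. \<not> classes_large n T (\<delta> / 2) z}
      \<le> real (card ?I) * (2 * exp (- (\<delta>\<^sup>2 / 2) * real n))"
  proof (rule prob_union_le)
    show "{z. \<not> classes_large n T (\<delta> / 2) z} \<subseteq> (\<Union>i\<in>?I. ?F i)"
      by (fastforce simp: classes_large_def not_le)
    show "measure_pmf.prob (latent_law n T \<Gamma>) (?F a) \<le> 2 * exp (- (\<delta>\<^sup>2 / 2) * real n)" if aI: "a \<in> ?I" for a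
    proof -
      obtain t q where a: "a = (t, q)" "t \<in> {1..T}" using aI by (cases a) auto
      have ge: "\<delta> \<le> measure_pmf.prob ?c {w. w t = q}"
        using pmf_stationary_ge[OF \<Gamma>] \<Gamma> a
        by (intro prob_chain_state_ge) (auto simp: pmf_kernel[OF \<Gamma>] pos_stochastic_def)
      have "measure_pmf.prob (latent_law n T \<Gamma>) (?F a)
          \<le> measure_pmf.prob (latent_law n T \<Gamma>) {z. \<delta> / 2 * real n
              \<le> \<bar>(\<Sum>i\<in>{1..n}. of_bool (z i t = q)) - (\<Sum>i\<in>{1..n}. measure_pmf.prob ?c {w. w t = q})\<bar>}"
      proof (rule measure_pmf.finite_measure_mono)
        have "(\<Sum>i\<in>{1..n}. of_bool (z i t = q)) = real (card {i \<in> {1..n}. z i t = q})" for z :: "'q labels"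
          by (simp add: of_bool_def sum.If_cases Int_def)
        moreover have "real n * \<delta> \<le> (\<Sum>i\<in>{1..n}. measure_pmf.prob ?c {w. w t = q})"
          using ge by (simp add: mult_left_mono)
        ultimately show "?F a \<subseteq> {z. \<delta> / 2 * real n
              \<le> \<bar>(\<Sum>i\<in>{1..n}. of_bool (z i t = q)) - (\<Sum>i\<in>{1..n}. measure_pmf.prob ?c {w. w t = q})\<bar>}"
          by (auto simp: a(1) algebra_simps)
      qed simp
      also have "\<dots> \<le> 2 * exp (- 2 * (\<delta> / 2 * real n)\<^sup>2 / real (card {1..n}))"
        unfolding latent_law_def
        by (rule Pi_pmf_Hoeffding[where X = "\<lambda>_ w. w t = q"]) (use \<Gamma> n in auto)
      also have "- 2 * (\<delta> / 2 * real n)\<^sup>2 / real (card {1..n}) = - (\<delta>\<^sup>2 / 2) * real n"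
        using n by (simp add: field_simps power2_eq_square)
      finally show ?thesis .
    qed
  qed auto
  also have "real (card ?I) * (2 * exp (- (\<delta>\<^sup>2 / 2) * real n)) = 2 * real T * real CARD('q) * exp (- (\<delta>\<^sup>2 / 2)) ^ n"
    by (simp add: card_cartesian_product exp_of_nat_mult[symmetric] mult_ac)
  finally show ?thesis .
qed

definition good_event :: "nat \<Rightarrow> nat \<Rightarrow> real \<Rightarrow> 'q::finite param \<Rightarrow> ('q labels \<times> graphs) set" where
  "good_event n T \<delta> \<theta> = {(z, x). z \<in> labelings n T \<and> x \<in> graph_space n T
     \<and> noise_bounded n T (snd \<theta>) z x \<and> classes_large n T (\<delta> / 2) z}"

lemma good_event_tail:
  fixes \<theta> :: "'q::finite param"
  assumes pos: "0 < \<delta>" "0 < \<zeta>" and \<theta>: "\<theta> \<in> bounded_params T \<delta> \<zeta>" and n: "n \<ge> 1"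
  shows "measure_pmf.prob (joint_law n T \<theta>) (- good_event n T \<delta> \<theta>)
    \<le> 2 * real T * (4 * exp (- 2)) ^ n + 2 * real T * real CARD('q) * exp (- (\<delta>\<^sup>2 / 2)) ^ n"
proof -
  let ?J = "joint_law n T \<theta>" and ?L = "latent_law n T (fst \<theta>)"
  let ?N = "{(z, x). \<not> noise_bounded n T (snd \<theta>) z x}" and ?C = "{(z, x). \<not> classes_large n T (\<delta> / 2) z}"
  have supp: "z \<in> labelings n T \<and> x \<in> graph_space n T" if "(z, x) \<in> set_pmf ?J" for z x
    using that set_latent_subset_labelings[of n T "fst \<theta>"] set_graph_law_subset[of n T "snd \<theta>"]
    by (auto simp: joint_law_def)
  have "measure_pmf.prob ?J (- good_event n T \<delta> \<theta>) \<le> measure_pmf.prob ?J (?N \<union> ?C)"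
    by (rule measure_pmf.finite_measure_mono_AE) (auto simp: AE_measure_pmf_iff good_event_def dest: supp)
  also have "\<dots> \<le> measure_pmf.prob ?J ?N + measure_pmf.prob ?J ?C"
    by (rule measure_Un_le) auto
  also have "measure_pmf.prob ?J ?N \<le> 2 * real T * (4 * exp (- 2)) ^ n"
  proof -
    have \<pi>: "snd \<theta> t $ q $ l \<in> {0..1}" if "t \<in> {1..T}" for t q l
    proof -
      have "snd \<theta> t $ q $ l \<in> {\<zeta>..1 - \<zeta>}" using \<theta> that by (auto simp: bounded_params_def)
      then show ?thesis using pos by simp
    qed
    have "measure_pmf.prob ?J ?N = (\<integral>z. measure_pmf.prob (graph_law n T (snd \<theta>) z) {x. \<not> noise_bounded n T (snd \<theta>) z x} \<partial>measure_pmf ?L)"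
      unfolding joint_law_def prob_bind_pmf by (simp add: vimage_def)
    also have "\<dots> \<le> 2 * real T * (4 * exp (- 2)) ^ n"
      using noise_bounded_tail[OF n \<pi>]
      by (intro measure_pmf.integral_le_const) (auto intro!: measure_pmf.integrable_const_bound[where B = 1])
    finally show ?thesis .
  qed
  also have "measure_pmf.prob ?J ?C \<le> 2 * real T * real CARD('q) * exp (- (\<delta>\<^sup>2 / 2)) ^ n"
  proof -
    have "measure_pmf.prob ?J ?C = measure_pmf.prob (map_pmf fst ?J) {z. \<not> classes_large n T (\<delta> / 2) z}"
    proof -
      have "?C = fst -` {z. \<not> classes_large n T (\<delta> / 2) z}" by auto
      then show ?thesis unfolding measure_map_pmf by (rule arg_cong)
    qed
    also have "map_pmf fst ?J = ?L"
      unfolding joint_law_def map_bind_pmf pmf.map_comp o_def fst_conv map_pmf_const bind_return_pmf' ..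
    also have "measure_pmf.prob ?L {z. \<not> classes_large n T (\<delta> / 2) z}
        \<le> 2 * real T * real CARD('q) * exp (- (\<delta>\<^sup>2 / 2)) ^ n"
    proof (rule classes_large_tail[OF _ pos(1) n])
      show "fst \<theta> \<in> pos_stochastic \<delta>" using \<theta> unfolding bounded_params_def by auto
    qed
    finally show ?thesis .
  qed
  finally show ?thesis by simp
qed

lemma good_event_tail_tendsto:
  assumes "0 < \<delta>"
  shows "(\<lambda>n. 2 * real T * (4 * exp (- 2)) ^ n + 2 * real T * Q * exp (- (\<delta>\<^sup>2 / 2)) ^ n) \<longlonglongrightarrow> (0::real)"
proof -
  \<comment> \<open>the number of pairs of vertex sets is \<open>4 ^ n\<close>, so the union bound needs \<open>4 < exp 2\<close>\<close>
  have "4 < exp (2 :: real)" using exp_lower_Taylor_quadratic[of 2] by simp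
  then have "norm (4 * exp (- 2 :: real)) < 1" by (simp add: exp_minus field_simps)
  from LIMSEQ_power_zero[OF this] have 1: "(\<lambda>n. (4 * exp (- 2 :: real)) ^ n) \<longlonglongrightarrow> 0" .
  have "norm (exp (- (\<delta>\<^sup>2 / 2))) < 1" using assms by simp
  from LIMSEQ_power_zero[OF this] have "(\<lambda>n. exp (- (\<delta>\<^sup>2 / 2)) ^ n) \<longlonglongrightarrow> 0" .
  with 1 have "(\<lambda>n. 2 * real T * (4 * exp (- 2)) ^ n + 2 * real T * Q * exp (- (\<delta>\<^sup>2 / 2)) ^ n)
      \<longlonglongrightarrow> 2 * real T * 0 + 2 * real T * Q * 0"
    by (intro tendsto_add tendsto_mult tendsto_const)
  then show ?thesis by simp
qed

section \<open>Existence of a maximizer\<close>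

lemma continuous_on_connectivity [continuous_intros]:
  "continuous_on S (\<lambda>\<theta> :: 'q::finite param. snd \<theta> t $ q $ l)"
proof -
  have "continuous_on S (\<lambda>\<theta> :: 'q param. snd \<theta> t)"
    by (rule continuous_on_compose2[OF continuous_on_product_coordinates continuous_on_snd[OF continuous_on_id]]) auto
  then show ?thesis by (intro continuous_intros)
qed

lemma continuous_on_ln_joint:
  assumes pos: "0 < \<delta>" "0 < \<zeta>" and z: "z \<in> labelings n T" and x: "x \<in> graph_space n T"
  shows "continuous_on (bounded_params T \<delta> \<zeta>) (\<lambda>\<theta> :: 'q::finite param. ln (pmf (joint_law n T \<theta>) (z, x)))"
proof -
  let ?S = "bounded_params T \<delta> \<zeta> :: 'q param set"
  have "continuous_on ?S (\<lambda>\<theta>. pmf (chain_pmf (stationary (fst \<theta>)) (\<lambda>_. kernel (fst \<theta>)) T) (z i))" for i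
    by (rule continuous_on_compose2[OF continuous_on_pmf_chain[OF pos(1)] continuous_on_fst[OF continuous_on_id]])
       (auto simp: bounded_params_def)
  then have "continuous_on ?S (\<lambda>\<theta>. pmf (latent_law n T (fst \<theta>)) z)"
    unfolding pmf_latent[OF z] by (intro continuous_on_prod) auto
  then have latent: "continuous_on ?S (\<lambda>\<theta>. ln (pmf (latent_law n T (fst \<theta>)) z))"
    by (rule continuous_on_ln) (metis latent_pos[OF pos _ x z] less_irrefl)
  have "continuous_on ?S (\<lambda>\<theta>. ln (pmf (bernoulli_pmf (snd \<theta> t $ q $ l)) b))" if t: "t \<in> {1..T}" for t q l b
  proof (rule continuous_on_eq)
    show "continuous_on ?S (\<lambda>\<theta>. ln (if b then snd \<theta> t $ q $ l else 1 - snd \<theta> t $ q $ l))"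
    proof (rule continuous_on_ln)
      show "continuous_on ?S (\<lambda>\<theta>. if b then snd \<theta> t $ q $ l else 1 - snd \<theta> t $ q $ l)"
        by (cases b) (auto intro!: continuous_intros)
      show "\<forall>\<theta>\<in>?S. (if b then snd \<theta> t $ q $ l else 1 - snd \<theta> t $ q $ l) \<noteq> 0"
      proof
        fix \<theta> assume "\<theta> \<in> ?S"
        then have "snd \<theta> t $ q $ l \<in> {\<zeta>..1 - \<zeta>}" using t by (auto simp: bounded_params_def)
        then have "0 < snd \<theta> t $ q $ l" "snd \<theta> t $ q $ l < 1" using pos by auto
        then show "(if b then snd \<theta> t $ q $ l else 1 - snd \<theta> t $ q $ l) \<noteq> 0" by auto
      qed
    qed
    show "ln (if b then snd \<theta> t $ q $ l else 1 - snd \<theta> t $ q $ l) = ln (pmf (bernoulli_pmf (snd \<theta> t $ q $ l)) b)"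
      if "\<theta> \<in> ?S" for \<theta>
    proof -
      have "snd \<theta> t $ q $ l \<in> {\<zeta>..1 - \<zeta>}" using that t by (auto simp: bounded_params_def)
      then have "0 \<le> snd \<theta> t $ q $ l" "snd \<theta> t $ q $ l \<le> 1" using pos by auto
      then show ?thesis by (cases b) auto
    qed
  qed
  then have "continuous_on ?S (\<lambda>\<theta>. edge_loglik n T (snd \<theta>) z x)"
    unfolding edge_loglik_def case_prod_beta by (intro continuous_on_sum) (auto simp: edges_def)
  from continuous_on_add[OF latent this] show ?thesis
    by (rule continuous_on_eq) (simp add: ln_joint[OF pos _ x z])
qed

text \<open>
  For small \<open>\<eta>\<close>, a compact piece of the parameter space. The second component vanishes off \<open>1..T\<close>, which
  places the set in a product of compact sets, and closeness to \<open>\<pi>\<close> replaces the strict identifiability conditions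
  by closed ones.
\<close>
definition near_params :: "nat \<Rightarrow> real \<Rightarrow> real \<Rightarrow> (nat \<Rightarrow> real^'q^'q) \<Rightarrow> real \<Rightarrow> 'q::finite param set" where
  "near_params T \<delta> \<zeta> \<pi> \<eta> =
     ({\<Gamma>. \<forall>q l. \<Gamma> $ q $ l \<in> {\<delta>..1 - \<delta>}} \<times>
      PiE UNIV (\<lambda>t. if t \<in> {1..T} then {P. \<forall>q l. P $ q $ l \<in> {\<zeta>..1 - \<zeta>}} else {0})) \<inter>
     {\<theta>. (\<forall>q. (\<Sum>l\<in>UNIV. fst \<theta> $ q $ l) = 1) \<and>
       (\<forall>t\<in>{1..T}. \<forall>q l. snd \<theta> t $ q $ l = snd \<theta> t $ l $ q) \<and>
       (\<forall>s\<in>{1..T}. \<forall>t\<in>{1..T}. \<forall>q. snd \<theta> s $ q $ q = snd \<theta> t $ q $ q) \<and>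
       (\<exists>\<sigma>\<in>{\<sigma>. \<sigma> permutes UNIV}. \<forall>t\<in>{1..T}. \<forall>q l. \<bar>\<pi> t $ q $ l - snd \<theta> t $ \<sigma> q $ \<sigma> l\<bar> \<le> \<eta>)}"

lemma compact_matrix_box: "compact {P :: real^'q^'q::finite. \<forall>q l. P $ q $ l \<in> {a..b}}"
proof -
  have "closed {P :: real^'q^'q. \<forall>q l. a \<le> P $ q $ l \<and> P $ q $ l \<le> b}"
    by (intro closed_Collect_all closed_Collect_conj closed_Collect_le continuous_intros)
  moreover have "bounded {P :: real^'q^'q. \<forall>q l. a \<le> P $ q $ l \<and> P $ q $ l \<le> b}"
  proof (rule boundedI)
    fix P :: "real^'q^'q" assume P: "P \<in> {P. \<forall>q l. a \<le> P $ q $ l \<and> P $ q $ l \<le> b}"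
    have "norm P \<le> (\<Sum>q\<in>UNIV. norm (P $ q))" unfolding norm_vec_def by (rule L2_set_le_sum) simp
    also have "\<dots> \<le> (\<Sum>q\<in>UNIV. \<Sum>l\<in>UNIV. \<bar>P $ q $ l\<bar>)" by (intro sum_mono norm_le_l1_cart)
    also have "\<dots> \<le> (\<Sum>q\<in>(UNIV::'q set). \<Sum>l\<in>(UNIV::'q set). \<bar>a\<bar> + \<bar>b\<bar>)"
    proof (intro sum_mono)
      fix q l
      have "a \<le> P $ q $ l" "P $ q $ l \<le> b" using P by auto
      then show "\<bar>P $ q $ l\<bar> \<le> \<bar>a\<bar> + \<bar>b\<bar>" by linarith
    qed
    finally show "norm P \<le> (\<Sum>q\<in>(UNIV::'q set). \<Sum>l\<in>(UNIV::'q set). \<bar>a\<bar> + \<bar>b\<bar>)" .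
  qed
  ultimately show ?thesis by (simp add: compact_eq_bounded_closed)
qed

lemma compact_near_params: "compact (near_params T \<delta> \<zeta> \<pi> \<eta> :: 'q::finite param set)"
  unfolding near_params_def
proof (rule compact_Int_closed)
  have "compactin (product_topology (\<lambda>_ :: nat. euclidean) UNIV)
      (PiE UNIV (\<lambda>t. if t \<in> {1..T} then {P :: real^'q^'q. \<forall>q l. P $ q $ l \<in> {\<zeta>..1 - \<zeta>}} else {0}))"
    unfolding compactin_PiE using compact_matrix_box[of \<zeta> "1 - \<zeta>", where 'q = 'q] by simp
  then have "compact (PiE UNIV (\<lambda>t :: nat. if t \<in> {1..T} then {P :: real^'q^'q. \<forall>q l. P $ q $ l \<in> {\<zeta>..1 - \<zeta>}} else {0}))"
    unfolding euclidean_product_topology compactin_euclidean_iff .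
  then show "compact ({\<Gamma> :: real^'q^'q. \<forall>q l. \<Gamma> $ q $ l \<in> {\<delta>..1 - \<delta>}} \<times>
      PiE UNIV (\<lambda>t :: nat. if t \<in> {1..T} then {P :: real^'q^'q. \<forall>q l. P $ q $ l \<in> {\<zeta>..1 - \<zeta>}} else {0}))"
    by (intro compact_Times compact_matrix_box)
  show "closed {\<theta> :: 'q param. (\<forall>q. (\<Sum>l\<in>UNIV. fst \<theta> $ q $ l) = 1) \<and>
       (\<forall>t\<in>{1..T}. \<forall>q l. snd \<theta> t $ q $ l = snd \<theta> t $ l $ q) \<and>
       (\<forall>s\<in>{1..T}. \<forall>t\<in>{1..T}. \<forall>q. snd \<theta> s $ q $ q = snd \<theta> t $ q $ q) \<and>
       (\<exists>\<sigma>\<in>{\<sigma>. \<sigma> permutes UNIV}. \<forall>t\<in>{1..T}. \<forall>q l. \<bar>\<pi> t $ q $ l - snd \<theta> t $ \<sigma> q $ \<sigma> l\<bar> \<le> \<eta>)}"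
  proof (intro closed_Collect_conj)
    show "closed {\<theta> :: 'q param. \<forall>q. (\<Sum>l\<in>UNIV. fst \<theta> $ q $ l) = 1}"
      by (intro closed_Collect_all closed_Collect_eq continuous_intros)
    show "closed {\<theta> :: 'q param. \<forall>t\<in>{1..T}. \<forall>q l. snd \<theta> t $ q $ l = snd \<theta> t $ l $ q}"
      unfolding Collect_ball_eq
      by (intro closed_INT ballI closed_Collect_all closed_Collect_eq continuous_intros)
    show "closed {\<theta> :: 'q param. \<forall>s\<in>{1..T}. \<forall>t\<in>{1..T}. \<forall>q. snd \<theta> s $ q $ q = snd \<theta> t $ q $ q}"
      unfolding Collect_ball_eq
      by (intro closed_INT ballI closed_Collect_all closed_Collect_eq continuous_intros)
    show "closed {\<theta> :: 'q param. \<exists>\<sigma>\<in>{\<sigma>. \<sigma> permutes UNIV}. \<forall>t\<in>{1..T}. \<forall>q l.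
        \<bar>\<pi> t $ q $ l - snd \<theta> t $ \<sigma> q $ \<sigma> l\<bar> \<le> \<eta>}"
      unfolding Collect_bex_eq Collect_ball_eq
      by (intro closed_UN closed_INT ballI closed_Collect_all closed_Collect_le continuous_intros)
         (simp add: finite_permutations)
  qed
qed

text \<open>
  Within \<open>\<eta>\<close> of \<open>\<pi>\<close> the diagonal values stay distinct. By symmetry, distinct diagonal values
  force distinct rows: two equal rows \<open>q\<close> and \<open>q'\<close> would give
  \<open>P $ q $ q = P $ q' $ q = P $ q $ q' = P $ q' $ q'\<close>.
\<close>
lemma near_params_subset:
  fixes \<pi> :: "nat \<Rightarrow> real^'q^'q::finite"
  assumes diag: "\<And>t q. t \<in> {1..T} \<Longrightarrow> \<pi> t $ q $ q = \<pi> 1 $ q $ q"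
    and gap: "\<And>q q'. q \<noteq> q' \<Longrightarrow> 2 * \<eta> < \<bar>\<pi> 1 $ q $ q - \<pi> 1 $ q' $ q'\<bar>"
  shows "near_params T \<delta> \<zeta> \<pi> \<eta> \<subseteq> param_space T \<delta> \<zeta>"
proof
  fix \<theta> :: "'q param" assume "\<theta> \<in> near_params T \<delta> \<zeta> \<pi> \<eta>"
  note K = this[unfolded near_params_def Int_iff mem_Times_iff mem_Collect_eq PiE_iff]
  have sums: "\<forall>q. (\<Sum>l\<in>UNIV. fst \<theta> $ q $ l) = 1" using K by (elim conjE)
  have \<Gamma>: "\<forall>q l. fst \<theta> $ q $ l \<in> {\<delta>..1 - \<delta>}" using K by (elim conjE)
  have bd: "\<forall>t\<in>UNIV. snd \<theta> t \<in> (if t \<in> {1..T} then {P. \<forall>q l. P $ q $ l \<in> {\<zeta>..1 - \<zeta>}} else {0})"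
    using K by (elim conjE)
  have sym: "\<forall>t\<in>{1..T}. \<forall>q l. snd \<theta> t $ q $ l = snd \<theta> t $ l $ q" using K by (elim conjE)
  have const: "\<forall>s\<in>{1..T}. \<forall>t\<in>{1..T}. \<forall>q. snd \<theta> s $ q $ q = snd \<theta> t $ q $ q" using K by (elim conjE)
  have "\<exists>\<sigma>\<in>{\<sigma>. \<sigma> permutes UNIV}. \<forall>t\<in>{1..T}. \<forall>q l. \<bar>\<pi> t $ q $ l - snd \<theta> t $ \<sigma> q $ \<sigma> l\<bar> \<le> \<eta>"
    using K by (elim conjE)
  then obtain \<sigma> where \<sigma>: "\<sigma> permutes UNIV"
    and close: "\<forall>t\<in>{1..T}. \<forall>q l. \<bar>\<pi> t $ q $ l - snd \<theta> t $ \<sigma> q $ \<sigma> l\<bar> \<le> \<eta>"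
    by (elim bexE CollectE)
  have diag_ne: "snd \<theta> t $ q $ q \<noteq> snd \<theta> t $ q' $ q'" if t: "t \<in> {1..T}" and "q \<noteq> q'" for t q q'
  proof
    assume eq: "snd \<theta> t $ q $ q = snd \<theta> t $ q' $ q'"
    obtain a b where ab: "q = \<sigma> a" "q' = \<sigma> b" using permutes_surj[OF \<sigma>] by (metis surj_def)
    then have "a \<noteq> b" using \<open>q \<noteq> q'\<close> by auto
    have "\<bar>\<pi> t $ a $ a - snd \<theta> t $ q $ q\<bar> \<le> \<eta>" "\<bar>\<pi> t $ b $ b - snd \<theta> t $ q' $ q'\<bar> \<le> \<eta>"
      unfolding ab using close t by blast+
    then show False
      using gap[OF \<open>a \<noteq> b\<close>] eq unfolding diag[OF t, of a] diag[OF t, of b] by linarith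
  qed
  have row_ne: "\<exists>l. snd \<theta> t $ q $ l \<noteq> snd \<theta> t $ q' $ l" if t: "t \<in> {1..T}" and "q \<noteq> q'" for t q q'
  proof (rule ccontr)
    assume "\<not> ?thesis"
    then have "snd \<theta> t $ q $ q = snd \<theta> t $ q' $ q" "snd \<theta> t $ q $ q' = snd \<theta> t $ q' $ q'" by auto
    moreover have "snd \<theta> t $ q $ q' = snd \<theta> t $ q' $ q" using sym t by blast
    ultimately show False using diag_ne[OF that] by metis
  qed
  show "\<theta> \<in> param_space T \<delta> \<zeta>"
    unfolding param_space_def case_prod_beta mem_Collect_eq
  proof (intro conjI)
    show "\<forall>t\<in>{1..T}. transpose (snd \<theta> t) = snd \<theta> t"
      using sym unfolding transpose_def vec_eq_iff vec_lambda_beta by blast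
    show "\<forall>t\<in>{1..T}. \<forall>q q'. q \<noteq> q' \<longrightarrow> (\<exists>l. snd \<theta> t $ q $ l \<noteq> snd \<theta> t $ q' $ l)"
      using row_ne by blast
    show "\<forall>t\<in>{1..T}. \<forall>q l. snd \<theta> t $ q $ l \<in> {\<zeta>..1 - \<zeta>}"
    proof (intro ballI allI)
      fix t q l assume "t \<in> {1..T}"
      then show "snd \<theta> t $ q $ l \<in> {\<zeta>..1 - \<zeta>}" using bspec[OF bd UNIV_I, of t] by simp
    qed
    show "\<forall>t\<in>{1..T}. inj (\<lambda>q. snd \<theta> t $ q $ q)"
      using diag_ne unfolding inj_def by blast
  qed (use sums \<Gamma> const in blast)+
qed

text \<open>
  The model only sees times \<open>1..T\<close>; clipping selects the representative in \<^const>\<open>near_params\<close>.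
\<close>
definition clip_times :: "nat \<Rightarrow> 'q::finite param \<Rightarrow> 'q param" where
  "clip_times T \<theta> = (fst \<theta>, \<lambda>t. if t \<in> {1..T} then snd \<theta> t else 0)"

lemma clip_times_near:
  fixes \<theta> :: "'q::finite param"
  assumes \<theta>: "\<theta> \<in> param_space T \<delta> \<zeta>" and \<sigma>: "\<sigma> permutes UNIV"
    and close: "\<And>t q l. t \<in> {1..T} \<Longrightarrow> \<bar>\<pi> t $ q $ l - snd \<theta> t $ \<sigma> q $ \<sigma> l\<bar> \<le> \<eta>"
  shows "clip_times T \<theta> \<in> near_params T \<delta> \<zeta> \<pi> \<eta>"
proof -
  have in_T: "snd (clip_times T \<theta>) t = snd \<theta> t" if "t \<in> {1..T}" for t using that by (simp add: clip_times_def)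
  have sym: "snd \<theta> t $ q $ l = snd \<theta> t $ l $ q" if "t \<in> {1..T}" for t q l
    using arg_cong[OF param_spaceD(1)[OF \<theta> that], of "\<lambda>P. P $ l $ q"] by (simp add: transpose_def)
  show ?thesis
    unfolding near_params_def Int_iff mem_Collect_eq mem_Times_iff
  proof (intro conjI ballI allI PiE_I bexI[of _ \<sigma>])
    show "fst (clip_times T \<theta>) $ q $ l \<in> {\<delta>..1 - \<delta>}" for q l
      using param_spaceD(6)[OF \<theta>] by (simp add: clip_times_def)
    show "(\<Sum>l\<in>UNIV. fst (clip_times T \<theta>) $ q $ l) = 1" for q
      using param_spaceD(5)[OF \<theta>] by (simp add: clip_times_def)
    show "snd (clip_times T \<theta>) t \<in> (if t \<in> {1..T} then {P. \<forall>q l. P $ q $ l \<in> {\<zeta>..1 - \<zeta>}} else {0})" for t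
      using param_spaceD(2)[OF \<theta>] by (simp add: clip_times_def)
    show "snd (clip_times T \<theta>) t $ q $ l = snd (clip_times T \<theta>) t $ l $ q" if "t \<in> {1..T}" for t q l
      unfolding in_T[OF that] by (rule sym[OF that])
    show "snd (clip_times T \<theta>) s $ q $ q = snd (clip_times T \<theta>) t $ q $ q" if "s \<in> {1..T}" "t \<in> {1..T}" for s t q
      unfolding in_T[OF that(1)] in_T[OF that(2)] by (rule param_spaceD(3)[OF \<theta> that])
    show "\<bar>\<pi> t $ q $ l - snd (clip_times T \<theta>) t $ \<sigma> q $ \<sigma> l\<bar> \<le> \<eta>" if "t \<in> {1..T}" for t q l
      unfolding in_T[OF that] by (rule close[OF that])
  qed (use \<sigma> in auto)
qed

text \<open>
  The parameter space is not closed, so compactness alone gives no maximizer. But every parameter that beats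
  \<open>\<theta>s\<close> lies, after clipping, in the compact set \<^const>\<open>near_params\<close>, which is contained in the parameter
  space. The criterion is continuous there, and its maximum over this set is global.
\<close>
lemma theta_tilde_exists:
  fixes \<theta>s :: "'q::finite param" and chihat :: "'q param \<Rightarrow> 'q vparam"
  assumes pos: "0 < \<delta>" "0 < \<zeta>" and T: "T \<ge> 1" and x: "x \<in> graph_space n T"
    and chihat: "\<And>\<theta>. \<theta> \<in> param_space T \<delta> \<zeta> \<Longrightarrow> is_chi_hat n T x \<theta> (chihat \<theta>)"
    and \<theta>s: "\<theta>s \<in> param_space T \<delta> \<zeta>" and \<eta>: "0 \<le> \<eta>"
    and gap: "\<And>q q'. q \<noteq> q' \<Longrightarrow> 2 * \<eta> < \<bar>snd \<theta>s 1 $ q $ q - snd \<theta>s 1 $ q' $ q'\<bar>"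
    and close: "\<And>\<theta>. \<theta> \<in> param_space T \<delta> \<zeta> \<Longrightarrow> profile n T x chihat \<theta>s \<le> profile n T x chihat \<theta> \<Longrightarrow>
      \<exists>\<sigma>. \<sigma> permutes UNIV \<and> (\<forall>t\<in>{1..T}. \<forall>q l. \<bar>snd \<theta>s t $ q $ l - snd \<theta> t $ \<sigma> q $ \<sigma> l\<bar> \<le> \<eta>)"
  shows "\<exists>\<theta>. is_theta_tilde n T \<delta> \<zeta> x chihat \<theta>"
proof -
  let ?K = "near_params T \<delta> \<zeta> (snd \<theta>s) \<eta>" and ?f = "profile n T x chihat"
  let ?L = "\<lambda>z \<theta>. ln (pmf (joint_law n T \<theta>) (z, x))"
  have one: "1 \<in> {1..T}" using T by simp
  have sub: "?K \<subseteq> param_space T \<delta> \<zeta>"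
    by (rule near_params_subset[where \<pi> = "snd \<theta>s", OF _ gap]) (rule param_spaceD(3)[OF \<theta>s _ one])
  have cont: "continuous_on ?K ?f"
    unfolding continuous_on_def
  proof
    fix \<theta> assume \<theta>: "\<theta> \<in> ?K"
    let ?F = "at \<theta> within ?K"
    have bK: "?K \<subseteq> bounded_params T \<delta> \<zeta>" using sub param_space_subset_bounded by (rule subset_trans)
    have "(?L z \<longlongrightarrow> ?L z \<theta>) ?F" if "z \<in> labelings n T" for z
      using continuous_on_subset[OF continuous_on_ln_joint[OF pos that x] bK] \<theta> unfolding continuous_on_def by blast
    then have "((\<lambda>\<theta>'. \<Sum>z\<in>labelings n T. \<bar>?L z \<theta>' - ?L z \<theta>\<bar>) \<longlongrightarrow> (\<Sum>z\<in>labelings n T. \<bar>?L z \<theta> - ?L z \<theta>\<bar>)) ?F"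
      by (intro tendsto_sum tendsto_rabs tendsto_diff tendsto_const)
    then have lim: "((\<lambda>\<theta>'. \<Sum>z\<in>labelings n T. \<bar>?L z \<theta>' - ?L z \<theta>\<bar>) \<longlongrightarrow> 0) ?F" by simp
    have "norm (?f \<theta>' - ?f \<theta>) \<le> (\<Sum>z\<in>labelings n T. \<bar>?L z \<theta>' - ?L z \<theta>\<bar>)" if "\<theta>' \<in> ?K" for \<theta>'
    proof -
      have p: "\<theta>' \<in> param_space T \<delta> \<zeta>" "\<theta> \<in> param_space T \<delta> \<zeta>" using that \<theta> sub by auto
      have "?f \<theta>' - ?f \<theta> \<le> (\<Sum>z\<in>labelings n T. \<bar>?L z \<theta>' - ?L z \<theta>\<bar>)"
        by (rule profile_diff_le[OF pos x chihat p])
      moreover have "?f \<theta> - ?f \<theta>' \<le> (\<Sum>z\<in>labelings n T. \<bar>?L z \<theta> - ?L z \<theta>'\<bar>)"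
        by (rule profile_diff_le[OF pos x chihat p(2,1)])
      ultimately show ?thesis by (simp add: abs_minus_commute abs_le_iff)
    qed
    then have "\<forall>\<^sub>F \<theta>' in ?F. norm (?f \<theta>' - ?f \<theta>) \<le> (\<Sum>z\<in>labelings n T. \<bar>?L z \<theta>' - ?L z \<theta>\<bar>)"
      by (simp add: eventually_at_filter)
    from Lim_null_comparison[OF this lim] show "(?f \<longlongrightarrow> ?f \<theta>) ?F" by (simp add: LIM_zero_iff)
  qed
  have near: "clip_times T \<theta> \<in> ?K" if \<theta>: "\<theta> \<in> param_space T \<delta> \<zeta>" and ge: "?f \<theta>s \<le> ?f \<theta>" for \<theta>
  proof -
    obtain \<sigma> where "\<sigma> permutes UNIV" "\<And>t q l. t \<in> {1..T} \<Longrightarrow> \<bar>snd \<theta>s t $ q $ l - snd \<theta> t $ \<sigma> q $ \<sigma> l\<bar> \<le> \<eta>"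
      using close[OF \<theta> ge] by blast
    then show ?thesis by (rule clip_times_near[OF \<theta>])
  qed
  have clip: "?f \<theta> \<le> ?f (clip_times T \<theta>)" if \<theta>: "\<theta> \<in> param_space T \<delta> \<zeta>" and ge: "?f \<theta>s \<le> ?f \<theta>" for \<theta>
  proof -
    have c: "clip_times T \<theta> \<in> param_space T \<delta> \<zeta>" using near[OF that] sub by blast
    note b = subsetD[OF param_space_subset_bounded \<theta>] subsetD[OF param_space_subset_bounded c]
    have "edge_loglik n T (snd (clip_times T \<theta>)) z x = edge_loglik n T (snd \<theta>) z x" for z
      unfolding edge_loglik_def by (rule sum.cong) (auto simp: edges_def clip_times_def)
    then have "?L z \<theta> = ?L z (clip_times T \<theta>)" if "z \<in> labelings n T" for z
      unfolding ln_joint[OF pos b(1) x that] ln_joint[OF pos b(2) x that] by (simp add: clip_times_def)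
    then have "(\<Sum>z\<in>labelings n T. \<bar>?L z \<theta> - ?L z (clip_times T \<theta>)\<bar>) = 0" by simp
    then show ?thesis using profile_diff_le[OF pos x chihat \<theta> c] by simp
  qed
  have "?K \<noteq> {}" using near[OF \<theta>s order_refl] by blast
  from continuous_attains_sup[OF compact_near_params this cont]
  obtain \<theta>0 where \<theta>0: "\<theta>0 \<in> ?K" "\<And>\<theta>. \<theta> \<in> ?K \<Longrightarrow> ?f \<theta> \<le> ?f \<theta>0" by blast
  have ge0: "?f \<theta> \<le> ?f \<theta>0" if "\<theta> \<in> param_space T \<delta> \<zeta>" "?f \<theta>s \<le> ?f \<theta>" for \<theta>
    using clip[OF that] \<theta>0(2)[OF near[OF that]] by linarith
  have "?f \<theta> \<le> ?f \<theta>0" if "\<theta> \<in> param_space T \<delta> \<zeta>" for \<theta>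
    using ge0[OF that] ge0[OF \<theta>s order_refl] by linarith
  then have "is_theta_tilde n T \<delta> \<zeta> x chihat \<theta>0"
    using \<theta>0(1) sub unfolding is_theta_tilde_def is_arg_max_linorder profile_def by blast
  then show ?thesis by blast
qed

section \<open>Consistency\<close>

text \<open>
  The element \<open>1\<close> keeps the minimum defined when the type has a single class.
\<close>
lemma diagonal_gap:
  fixes P :: "real^'q^'q::finite"
  assumes "inj (\<lambda>q. P $ q $ q)"
  shows "\<exists>g>0. \<forall>q q'. q \<noteq> q' \<longrightarrow> g \<le> \<bar>P $ q $ q - P $ q' $ q'\<bar>"
proof -
  let ?S = "insert 1 ((\<lambda>(q, q'). \<bar>P $ q $ q - P $ q' $ q'\<bar>) ` {(q, q'). q \<noteq> q'})"
  have "0 < Min ?S" using assms by (subst Min_gr_iff) (auto simp: inj_def)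
  moreover have "Min ?S \<le> \<bar>P $ q $ q - P $ q' $ q'\<bar>" if "q \<noteq> q'" for q q'
    by (rule Min_le) (use that in auto)
  ultimately show ?thesis by blast
qed

theorem corollary6:
  fixes T :: nat and \<delta> \<zeta> \<epsilon> :: real and \<theta>star :: "'q::finite param"
    and r :: "nat \<Rightarrow> real"
    and chi_hat :: "nat \<Rightarrow> graphs \<Rightarrow> 'q param \<Rightarrow> 'q vparam"
    and theta_tilde :: "nat \<Rightarrow> graphs \<Rightarrow> 'q param"
  assumes "T \<ge> 1" and "CARD('q) \<ge> 2"
    and "0 < \<delta>" and "\<delta> < 1 / real CARD('q)" and "0 < \<zeta>" and "\<zeta> < 1 / 2"
    and "\<theta>star \<in> param_space T \<delta> \<zeta>"
    and "\<And>n x \<theta>. \<lbrakk>n \<ge> 1; x \<in> graph_space n T; \<theta> \<in> param_space T \<delta> \<zeta>\<rbrakk>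
           \<Longrightarrow> is_chi_hat n T x \<theta> (chi_hat n x \<theta>)"
    and "\<And>n x. \<lbrakk>n \<ge> 1; x \<in> graph_space n T; \<exists>\<theta>. is_theta_tilde n T \<delta> \<zeta> x (chi_hat n x) \<theta>\<rbrakk>
           \<Longrightarrow> is_theta_tilde n T \<delta> \<zeta> x (chi_hat n x) (theta_tilde n x)"
    and "\<epsilon> > 0"
    and "\<And>n. n \<ge> 1 \<Longrightarrow> r n > 0" and "filterlim r at_top sequentially"
    and "r \<in> o(\<lambda>n. real n powr (1 / 4))"
  shows "(\<lambda>n. 1 / 2 * measure_pmf.prob (obs_law n T \<theta>star)
            {x. dist_up_to_perm T (snd (theta_tilde n x)) (snd \<theta>star)
                  > \<epsilon> * r n / real n powr (1 / 4)}) \<longlonglongrightarrow> 0"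
proof -
  note T = assms(1) and \<theta>s = assms(7) and chi_hat = assms(8) and theta_tilde = assms(9)
  note pos = \<open>0 < \<delta>\<close> \<open>0 < \<zeta>\<close>
  let ?Q = "real CARD('q)"
  let ?C = "rate_const ?Q T \<delta> \<zeta> (\<delta> / 2)"
  let ?E = "\<lambda>n. {x. dist_up_to_perm T (snd (theta_tilde n x)) (snd \<theta>star) > \<epsilon> * r n / real n powr (1 / 4)}"
  let ?b = "\<lambda>n. 2 * real T * (4 * exp (- 2)) ^ n + 2 * real T * ?Q * exp (- (\<delta>\<^sup>2 / 2)) ^ n"
  have "1 / ?Q \<le> 1" using assms(2) by simp
  then have le1: "\<delta> \<le> 1" "\<zeta> \<le> 1" using assms(4,6) by linarith+
  have C0: "0 \<le> ?C"
    unfolding rate_const_def using pos le1 by (intro mult_nonneg_nonneg real_sqrt_ge_zero add_nonneg_nonneg) auto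
  have one: "1 \<in> {1..T}" using T by simp
  obtain g where g: "0 < g" "\<And>q q'. q \<noteq> q' \<Longrightarrow> g \<le> \<bar>snd \<theta>star 1 $ q $ q - snd \<theta>star 1 $ q' $ q'\<bar>"
    using diagonal_gap[OF param_spaceD(4)[OF \<theta>s one]] by blast
  have "((\<lambda>n. 2 * (?C * real n powr (- 1/4))) \<longlongrightarrow> 2 * (?C * 0)) sequentially"
    by (intro tendsto_mult tendsto_const tendsto_neg_powr filterlim_real_sequentially) simp
  then have ev1: "\<forall>\<^sub>F n in sequentially. 2 * (?C * real n powr (- 1/4)) < g"
    using g(1) by (intro order_tendstoD(2)) auto
  have ev2: "\<forall>\<^sub>F n in sequentially. ?C / \<epsilon> \<le> r n"
    using assms(12) by (simp add: filterlim_at_top)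
  have ev3: "\<forall>\<^sub>F n in sequentially. 2 * ?Q / (\<delta> / 2) \<le> real n"
    using filterlim_real_sequentially by (simp add: filterlim_at_top)
  have "\<forall>\<^sub>F n in sequentially. measure_pmf.prob (obs_law n T \<theta>star) (?E n) \<le> ?b n"
    using ev1 ev2 ev3 eventually_ge_at_top[of 1]
  proof eventually_elim
    case (elim n)
    let ?\<eta> = "?C * real n powr (- 1/4)"
    have n: "2 * ?Q \<le> \<delta> / 2 * real n" using elim(3) pos by (simp add: field_simps)
    have gap: "2 * ?\<eta> < \<bar>snd \<theta>star 1 $ q $ q - snd \<theta>star 1 $ q' $ q'\<bar>" if "q \<noteq> q'" for q q'
      using elim(1) g(2)[OF that] by linarith
    \<comment> \<open>on the good event the maximizer exists, hence the estimator is one and beats the true parameter\<close>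
    have "x \<notin> ?E n" if "(z, x) \<in> good_event n T \<delta> \<theta>star" for z x
    proof -
      from that have z: "z \<in> labelings n T" and x: "x \<in> graph_space n T"
        and noise: "noise_bounded n T (snd \<theta>star) z x" and large: "classes_large n T (\<delta> / 2) z"
        by (auto simp: good_event_def)
      note ch = chi_hat[OF elim(4) x]
      have close: "\<exists>\<sigma>. \<sigma> permutes UNIV \<and> (\<forall>t\<in>{1..T}. \<forall>q l. \<bar>snd \<theta>star t $ q $ l - snd \<theta> t $ \<sigma> q $ \<sigma> l\<bar> \<le> ?\<eta>)"
        if "\<theta> \<in> param_space T \<delta> \<zeta>" "profile n T x (chi_hat n x) \<theta>star \<le> profile n T x (chi_hat n x) \<theta>" for \<theta>
        using near_maximizer_close[OF pos le1 T x z ch \<theta>s that(1) noise large that(2) _ n gap] pos by simp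
      have "\<exists>\<theta>. is_theta_tilde n T \<delta> \<zeta> x (chi_hat n x) \<theta>"
        by (rule theta_tilde_exists[OF pos T x ch \<theta>s _ gap close]) (use C0 in auto)
      from theta_tilde[OF elim(4) x this]
      have max: "theta_tilde n x \<in> param_space T \<delta> \<zeta>"
        "profile n T x (chi_hat n x) \<theta>star \<le> profile n T x (chi_hat n x) (theta_tilde n x)"
        using \<theta>s unfolding is_theta_tilde_def is_arg_max_linorder profile_def by blast+
      obtain \<sigma> where \<sigma>: "\<sigma> permutes UNIV"
        "\<And>t q l. t \<in> {1..T} \<Longrightarrow> \<bar>snd \<theta>star t $ q $ l - snd (theta_tilde n x) t $ \<sigma> q $ \<sigma> l\<bar> \<le> ?\<eta>"
        using close[OF max] by blast
      have "dist_up_to_perm T (snd (theta_tilde n x)) (snd \<theta>star) \<le> ?\<eta>"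
        by (rule dist_up_to_perm_le[OF T \<sigma>])
      also have "?\<eta> = ?C / real n powr (1 / 4)" by (simp add: powr_minus_divide)
      also have "\<dots> \<le> \<epsilon> * r n / real n powr (1 / 4)"
        using elim(2) assms(10) by (intro divide_right_mono) (auto simp: field_simps)
      finally show ?thesis by simp
    qed
    then have "snd -` ?E n \<subseteq> - good_event n T \<delta> \<theta>star" by auto
    then have "measure_pmf.prob (obs_law n T \<theta>star) (?E n) \<le> measure_pmf.prob (joint_law n T \<theta>star) (- good_event n T \<delta> \<theta>star)"
      unfolding obs_law_def measure_map_pmf by (intro measure_pmf.finite_measure_mono) auto
    also have "\<dots> \<le> ?b n"
      by (rule good_event_tail[OF pos subsetD[OF param_space_subset_bounded \<theta>s] elim(4)])
    finally show ?case .
  qed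
  then have "(\<lambda>n. measure_pmf.prob (obs_law n T \<theta>star) (?E n)) \<longlonglongrightarrow> 0"
    by (intro tendsto_sandwich[OF _ _ tendsto_const good_event_tail_tendsto[OF pos(1), of T ?Q]]) auto
  from tendsto_mult_left[OF this, of "1 / 2"] show ?thesis by simp
qed

end
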